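(* Let $A$ and $B$ be finitely generated nilpotent groups, let $C_A\le A$ and $C_B\le B$ be subgroups, and let $\phi:C_A\to C_B$ be an isomorphism. Let $\xi_iA$ and $\xi_iB$ denote the $i$-th terms of the upper central series of $A$ and $B$. Suppose that the filtrations of $A$ and $B$ given by their upper central series are compatible, i.e. for every $i$, $\phi$ restricts to an isomorphism $\phi_i$ from $\xi_iA\cap C_A$ onto $\xi_iB\cap C_B$. Then the generalized free product $G=\{A*B;\ C_A=C_B\}$ of $A$ and $B$ amalgamating $C_A$ with $C_B$ via $\phi$ is poly-residually solvable.
   Context: The generalized free product (amalgamated product) $\{A*B;\ C_A=C_B\}$ is the quotient of the free product $A*B$ by the normal closure of the elements $c\,(\phi(c))^{-1}$, $c\in C_A$. The upper central series is $\xi_0A=1$, $\xi_{i+1}A/\xi_iA=$ center of $A/\xi_iA$. A group $G$ is residually solvable if for every non-identity $g\in G$ there is a homomorphism from $G$ onto a solvable group under which the image of $g$ is not the identity. A group $G$ is poly-residually solvable if it has a finite normal series $1=G_0\le G_1\le\cdots\le G_l=G$ (each $G_i$ normal in $G$) such that every quotient $G_{i+1}/G_i$, $0\le i\le l-1$, is residually solvable. *)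

theory Defs
  imports "HOL-Algebra.Solvable_Groups"
begin

section \<open>Nilpotent and residually solvable groups\<close>

definition finitely_generated :: "('a, 'b) monoid_scheme \<Rightarrow> bool"
  where "finitely_generated G \<longleftrightarrow>
    (\<exists>S. finite S \<and> S \<subseteq> carrier G \<and> generate G S = carrier G)"

definition center :: "('a, 'b) monoid_scheme \<Rightarrow> 'a set"
  where "center G = {z \<in> carrier G. \<forall>x \<in> carrier G. z \<otimes>\<^bsub>G\<^esub> x = x \<otimes>\<^bsub>G\<^esub> z}"

(* The term of index i + 1 is the full preimage in G of the center of G Mod (term of index i). *)
primrec upper_central :: "('a, 'b) monoid_scheme \<Rightarrow> nat \<Rightarrow> 'a set"
  where
    "upper_central G 0 = {\<one>\<^bsub>G\<^esub>}"
  | "upper_central G (Suc i) =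
      {x \<in> carrier G. upper_central G i #>\<^bsub>G\<^esub> x \<in> center (G Mod upper_central G i)}"

definition nilpotent :: "('a, 'b) monoid_scheme \<Rightarrow> bool"
  where "nilpotent G \<longleftrightarrow> (\<exists>n. upper_central G n = carrier G)"

(* The solvable groups H range over the type of sets of elements of G. This is no restriction:
   a homomorphic image of G is isomorphic to a factor group of G, which lives on that type;
   see residually_solvable_witness below. *)
definition residually_solvable :: "('a, 'b) monoid_scheme \<Rightarrow> bool"
  where "residually_solvable G \<longleftrightarrow>
    (\<forall>g \<in> carrier G. g \<noteq> \<one>\<^bsub>G\<^esub> \<longrightarrow>
      (\<exists>(H :: 'a set monoid) f.
        group H \<and> solvable H \<and> f \<in> epi G H \<and> f g \<noteq> \<one>\<^bsub>H\<^esub>))"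

lemma residually_solvable_witness:
  assumes "group G" "group K" "solvable K" "h \<in> epi G K" "g \<in> carrier G" "h g \<noteq> \<one>\<^bsub>K\<^esub>"
  shows "\<exists>(H :: 'a set monoid) f.
    group H \<and> solvable H \<and> f \<in> epi (G :: ('a, 'b) monoid_scheme) H \<and> f g \<noteq> \<one>\<^bsub>H\<^esub>"
proof -
  interpret group_hom G K h
    using assms(1,2,4) by (simp add: group_hom_def group_hom_axioms_def epi_def)
  let ?N = "kernel G K h"
  interpret N: normal ?N G by (rule normal_kernel)
  interpret F: group "G Mod ?N" by (rule N.factorgroup_is_group)
  have surj: "h ` carrier G = carrier K"
    using assms(4) by (simp add: epi_def)
  let ?F = "\<lambda>X. the_elem (h ` X)"
  have iso: "?F \<in> iso (G Mod ?N) K"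
    by (rule FactGroup_iso_set[OF surj])
  then interpret F: group_hom "G Mod ?N" K ?F
    using F.is_group assms(2) by (simp add: group_hom_def group_hom_axioms_def iso_def)
  have "solvable (G Mod ?N)"
  proof (rule F.inj_hom_imp_solvable[OF _ assms(3)])
    show "inj_on ?F (carrier (G Mod ?N))"
      using iso unfolding iso_def bij_betw_def by blast
  qed
  moreover have "(\<lambda>x. ?N #>\<^bsub>G\<^esub> x) \<in> epi G (G Mod ?N)"
    unfolding epi_def using N.r_coset_hom_Mod by (auto simp: carrier_FactGroup)
  moreover have "?N #>\<^bsub>G\<^esub> g \<noteq> \<one>\<^bsub>G Mod ?N\<^esub>"
  proof
    assume "?N #>\<^bsub>G\<^esub> g = \<one>\<^bsub>G Mod ?N\<^esub>"
    then have "?N #>\<^bsub>G\<^esub> g = ?N"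
      by (simp add: FactGroup_def)
    then have "g \<in> ?N"
      using G.rcos_self[OF assms(5) N.subgroup_axioms] by blast
    then show False using assms(6) unfolding kernel_def by blast
  qed
  ultimately show ?thesis
    using N.factorgroup_is_group by blast
qed

definition poly_residually_solvable :: "('a, 'b) monoid_scheme \<Rightarrow> bool"
  where "poly_residually_solvable G \<longleftrightarrow>
    (\<exists>(l :: nat) N. N 0 = {\<one>\<^bsub>G\<^esub>} \<and> N l = carrier G \<and>
      (\<forall>i \<le> l. N i \<lhd> G) \<and>
      (\<forall>i < l. N i \<subseteq> N (Suc i) \<and>
        residually_solvable ((G\<lparr>carrier := N (Suc i)\<rparr>) Mod N i)))"

section \<open>Free products and amalgamated products\<close>

definition fp_words :: "('a, 'c) monoid_scheme \<Rightarrow> ('b, 'd) monoid_scheme \<Rightarrow> ('a + 'b) list set"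
  where "fp_words A B = lists (carrier A <+> carrier B)"

(* The free product consists of the words with letters in the disjoint union of A and B, modulo
   the equivalence generated by multiplying adjacent letters of the same factor and by deleting
   the identity elements of the factors. *)
inductive_set fp_rel ::
    "('a, 'c) monoid_scheme \<Rightarrow> ('b, 'd) monoid_scheme \<Rightarrow> (('a + 'b) list \<times> ('a + 'b) list) set"
  for A B where
    refl: "w \<in> fp_words A B \<Longrightarrow> (w, w) \<in> fp_rel A B"
  | sym: "(v, w) \<in> fp_rel A B \<Longrightarrow> (w, v) \<in> fp_rel A B"
  | trans: "(u, v) \<in> fp_rel A B \<Longrightarrow> (v, w) \<in> fp_rel A B \<Longrightarrow> (u, w) \<in> fp_rel A B"
  | mult_left: "\<lbrakk>u \<in> fp_words A B; v \<in> fp_words A B; x \<in> carrier A; y \<in> carrier A\<rbrakk> \<Longrightarrow>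
      (u @ [Inl x, Inl y] @ v, u @ [Inl (x \<otimes>\<^bsub>A\<^esub> y)] @ v) \<in> fp_rel A B"
  | mult_right: "\<lbrakk>u \<in> fp_words A B; v \<in> fp_words A B; x \<in> carrier B; y \<in> carrier B\<rbrakk> \<Longrightarrow>
      (u @ [Inr x, Inr y] @ v, u @ [Inr (x \<otimes>\<^bsub>B\<^esub> y)] @ v) \<in> fp_rel A B"
  | one_left: "\<lbrakk>u \<in> fp_words A B; v \<in> fp_words A B\<rbrakk> \<Longrightarrow>
      (u @ [Inl \<one>\<^bsub>A\<^esub>] @ v, u @ v) \<in> fp_rel A B"
  | one_right: "\<lbrakk>u \<in> fp_words A B; v \<in> fp_words A B\<rbrakk> \<Longrightarrow>
      (u @ [Inr \<one>\<^bsub>B\<^esub>] @ v, u @ v) \<in> fp_rel A B"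

definition free_product ::
    "('a, 'c) monoid_scheme \<Rightarrow> ('b, 'd) monoid_scheme \<Rightarrow> ('a + 'b) list set monoid"
  where "free_product A B =
    \<lparr>carrier = fp_words A B // fp_rel A B,
     mult = (\<lambda>X Y. \<Union>x\<in>X. \<Union>y\<in>Y. fp_rel A B `` {x @ y}),
     one = fp_rel A B `` {[]}\<rparr>"

definition fp_inl ::
    "('a, 'c) monoid_scheme \<Rightarrow> ('b, 'd) monoid_scheme \<Rightarrow> 'a \<Rightarrow> ('a + 'b) list set"
  where "fp_inl A B a = fp_rel A B `` {[Inl a]}"

definition fp_inr ::
    "('a, 'c) monoid_scheme \<Rightarrow> ('b, 'd) monoid_scheme \<Rightarrow> 'b \<Rightarrow> ('a + 'b) list set"
  where "fp_inr A B b = fp_rel A B `` {[Inr b]}"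

definition normal_closure :: "('a, 'b) monoid_scheme \<Rightarrow> 'a set \<Rightarrow> 'a set"
  where "normal_closure G S = \<Inter>{N. N \<lhd> G \<and> S \<subseteq> N}"

(* The second amalgamated subgroup is the image of C under \<phi>. *)
definition amalgamated_product ::
    "('a, 'c) monoid_scheme \<Rightarrow> ('b, 'd) monoid_scheme \<Rightarrow> 'a set \<Rightarrow> ('a \<Rightarrow> 'b)
      \<Rightarrow> ('a + 'b) list set set monoid"
  where "amalgamated_product A B C \<phi> =
    (let F = free_product A B
     in F Mod normal_closure F
          {fp_inl A B c \<otimes>\<^bsub>F\<^esub> inv\<^bsub>F\<^esub> (fp_inr A B (\<phi> c)) | c. c \<in> C})"

section \<open>The free product is a group\<close>

lemma fp_words_simps [simp]:
  "[] \<in> fp_words A B"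
  "u @ v \<in> fp_words A B \<longleftrightarrow> u \<in> fp_words A B \<and> v \<in> fp_words A B"
  "Inl a # w \<in> fp_words A B \<longleftrightarrow> a \<in> carrier A \<and> w \<in> fp_words A B"
  "Inr b # w \<in> fp_words A B \<longleftrightarrow> b \<in> carrier B \<and> w \<in> fp_words A B"
  by (auto simp: fp_words_def)

context
  fixes A :: "('a, 'c) monoid_scheme" and B :: "('b, 'd) monoid_scheme"
  assumes A: "group A" and B: "group B"
begin

interpretation A: group A by (rule A)
interpretation B: group B by (rule B)

lemma fp_rel_words:
  assumes "(v, w) \<in> fp_rel A B" shows "v \<in> fp_words A B" "w \<in> fp_words A B"
  using assms by (induction) auto

lemma equiv_fp_rel: "equiv (fp_words A B) (fp_rel A B)"
proof (rule equivI)
  show "fp_rel A B \<subseteq> fp_words A B \<times> fp_words A B"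
    using fp_rel_words by auto
  show "refl_on (fp_words A B) (fp_rel A B)"
    by (simp add: refl_on_def fp_rel.refl)
  show "Relation.sym (fp_rel A B)"
    by (blast intro: symI fp_rel.sym)
  show "Relation.trans (fp_rel A B)"
    by (blast intro: transI fp_rel.trans)
qed

lemma fp_rel_context:
  assumes "(v, w) \<in> fp_rel A B" "p \<in> fp_words A B" "q \<in> fp_words A B"
  shows "(p @ v @ q, p @ w @ q) \<in> fp_rel A B"
  using assms
proof (induction)
  case (mult_left u v x y)
  then show ?case using fp_rel.mult_left[of "p @ u" A B "v @ q" x y] by simp
next
  case (mult_right u v x y)
  then show ?case using fp_rel.mult_right[of "p @ u" A B "v @ q" x y] by simp
next
  case (one_left u v)
  then show ?case using fp_rel.one_left[of "p @ u" A B "v @ q"] by simp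
next
  case (one_right u v)
  then show ?case using fp_rel.one_right[of "p @ u" A B "v @ q"] by simp
next
  case (trans u v w)
  then show ?case by (blast intro: fp_rel.trans)
next
  case (sym v w)
  then show ?case by (blast intro: fp_rel.sym)
next
  case (refl w)
  then show ?case by (simp add: fp_rel.refl)
qed

lemma fp_rel_append:
  assumes "(u, u') \<in> fp_rel A B" "(v, v') \<in> fp_rel A B"
  shows "(u @ v, u' @ v') \<in> fp_rel A B"
proof (rule fp_rel.trans)
  show "(u @ v, u' @ v) \<in> fp_rel A B"
    using fp_rel_context[OF assms(1), of "[]" v] fp_rel_words[OF assms(2)] by simp
  show "(u' @ v, u' @ v') \<in> fp_rel A B"
    using fp_rel_context[OF assms(2), of u' "[]"] fp_rel_words[OF assms(1)] by simp
qed

lemma fp_class_mult: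
  assumes "u \<in> fp_words A B" "v \<in> fp_words A B"
  shows "fp_rel A B `` {u} \<otimes>\<^bsub>free_product A B\<^esub> fp_rel A B `` {v} = fp_rel A B `` {u @ v}"
proof -
  have "(\<Union>x\<in>fp_rel A B `` {u}. \<Union>y\<in>fp_rel A B `` {v}. fp_rel A B `` {x @ y}) =
      (\<Union>x\<in>fp_rel A B `` {u}. \<Union>y\<in>fp_rel A B `` {v}. fp_rel A B `` {u @ v})"
    by (intro SUP_cong HOL.refl equiv_class_eq[OF equiv_fp_rel, symmetric])
      (simp add: fp_rel_append)
  moreover have "u \<in> fp_rel A B `` {u}" "v \<in> fp_rel A B `` {v}"
    using assms by (auto intro: fp_rel.refl)
  ultimately show ?thesis
    unfolding free_product_def monoid.simps by blast
qed

lemma fp_left_inverse: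
  assumes "w \<in> fp_words A B"
  shows "\<exists>v \<in> fp_words A B. (v @ w, []) \<in> fp_rel A B"
  using assms
proof (induction w)
  case Nil
  show ?case by (rule bexI[of _ "[]"]) (auto intro: fp_rel.refl)
next
  case (Cons c w)
  obtain d where d: "[d] \<in> fp_words A B" "([d, c], []) \<in> fp_rel A B"
  proof (cases c)
    case (Inl a)
    then have a: "a \<in> carrier A" using Cons.prems by simp
    show ?thesis
      using that[of "Inl (inv\<^bsub>A\<^esub> a)"] a Inl fp_rel.mult_left[of "[]" A B "[]" "inv\<^bsub>A\<^esub> a" a]
        fp_rel.one_left[of "[]" A B "[]"] fp_rel.trans by fastforce
  next
    case (Inr b)
    then have b: "b \<in> carrier B" using Cons.prems by simp
    show ?thesis
      using that[of "Inr (inv\<^bsub>B\<^esub> b)"] b Inr fp_rel.mult_right[of "[]" A B "[]" "inv\<^bsub>B\<^esub> b" b]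
        fp_rel.one_right[of "[]" A B "[]"] fp_rel.trans by fastforce
  qed
  have w: "w \<in> fp_words A B" using Cons.prems by (auto simp: fp_words_def)
  then obtain v where v: "v \<in> fp_words A B" "(v @ w, []) \<in> fp_rel A B"
    using Cons.IH by blast
  have "(v @ [d, c] @ w, v @ [] @ w) \<in> fp_rel A B"
    by (rule fp_rel_context[OF d(2) v(1) w])
  then have "((v @ [d]) @ c # w, []) \<in> fp_rel A B"
    using fp_rel.trans[OF _ v(2)] by simp
  then show ?case using v(1) d(1) by (intro bexI[of _ "v @ [d]"]) auto
qed

lemma fp_carrier: "carrier (free_product A B) = fp_words A B // fp_rel A B"
  and fp_one: "\<one>\<^bsub>free_product A B\<^esub> = fp_rel A B `` {[]}"
  by (simp_all add: free_product_def)

lemma group_free_product: "group (free_product A B)"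
proof (rule groupI)
  fix X Y Z
  assume "X \<in> carrier (free_product A B)"
  then obtain x where x: "x \<in> fp_words A B" "X = fp_rel A B `` {x}"
    by (auto simp: fp_carrier elim: quotientE)
  show "\<one>\<^bsub>free_product A B\<^esub> \<otimes>\<^bsub>free_product A B\<^esub> X = X"
    using x by (simp add: fp_one fp_class_mult)
  obtain v where v: "v \<in> fp_words A B" "(v @ x, []) \<in> fp_rel A B"
    using fp_left_inverse[OF x(1)] by blast
  then show "\<exists>V\<in>carrier (free_product A B). V \<otimes>\<^bsub>free_product A B\<^esub> X = \<one>\<^bsub>free_product A B\<^esub>"
    using x equiv_class_eq[OF equiv_fp_rel v(2)]
    by (intro bexI[of _ "fp_rel A B `` {v}"])
      (auto simp: fp_one fp_class_mult fp_carrier intro: quotientI)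
  assume "Y \<in> carrier (free_product A B)"
  then obtain y where y: "y \<in> fp_words A B" "Y = fp_rel A B `` {y}"
    by (auto simp: fp_carrier elim: quotientE)
  show "X \<otimes>\<^bsub>free_product A B\<^esub> Y \<in> carrier (free_product A B)"
    using x y by (auto simp: fp_class_mult fp_carrier intro: quotientI)
  assume "Z \<in> carrier (free_product A B)"
  then obtain z where z: "z \<in> fp_words A B" "Z = fp_rel A B `` {z}"
    by (auto simp: fp_carrier elim: quotientE)
  show "X \<otimes>\<^bsub>free_product A B\<^esub> Y \<otimes>\<^bsub>free_product A B\<^esub> Z =
      X \<otimes>\<^bsub>free_product A B\<^esub> (Y \<otimes>\<^bsub>free_product A B\<^esub> Z)"
    using x y z by (simp add: fp_class_mult)
qed (auto simp: fp_one fp_carrier intro: quotientI)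

lemma fp_inl_hom: "fp_inl A B \<in> hom A (free_product A B)"
proof (rule homI)
  fix x y assume "x \<in> carrier A" "y \<in> carrier A"
  then show "fp_inl A B (x \<otimes>\<^bsub>A\<^esub> y) = fp_inl A B x \<otimes>\<^bsub>free_product A B\<^esub> fp_inl A B y"
    using equiv_class_eq[OF equiv_fp_rel fp_rel.mult_left[of "[]" A B "[]" x y]]
    by (simp add: fp_inl_def fp_class_mult)
qed (auto simp: fp_inl_def fp_carrier intro: quotientI)

lemma fp_inr_hom: "fp_inr A B \<in> hom B (free_product A B)"
proof (rule homI)
  fix x y assume "x \<in> carrier B" "y \<in> carrier B"
  then show "fp_inr A B (x \<otimes>\<^bsub>B\<^esub> y) = fp_inr A B x \<otimes>\<^bsub>free_product A B\<^esub> fp_inr A B y"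
    using equiv_class_eq[OF equiv_fp_rel fp_rel.mult_right[of "[]" A B "[]" x y]]
    by (simp add: fp_inr_def fp_class_mult)
qed (auto simp: fp_inr_def fp_carrier intro: quotientI)

end

end

theory Submission
  imports Defs "HOL-Algebra.Bij" "HOL-Algebra.Zassenhaus"
begin

text \<open>Let \<open>L\<^sub>i\<close> be the normal closure in \<open>G\<close> of the images of \<open>\<xi>\<^sub>i A\<close> and \<open>\<xi>\<^sub>i B\<close>. Starting from
  \<open>M\<^sub>0 = L\<^sub>i\<^sub>+\<^sub>1\<close>, put \<open>M\<^sub>k\<^sub>+\<^sub>1 = [M\<^sub>k, M\<^sub>k] L\<^sub>i\<close>; then \<open>L\<^sub>i\<^sub>+\<^sub>1\<close> is residually solvable modulo the
  intersection \<open>R\<^sub>i\<close> of the \<open>M\<^sub>k\<close>. Every element of \<open>G\<close> outside \<open>L\<^sub>i C\<close> is, up to \<open>L\<^sub>i\<close>, a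
  reduced word, i.e. a path without backtracking in the Bass-Serre graph. If no reduced word of
  length at most \<open>n\<close> lies in \<open>M\<^sub>k C\<close>, then a reduced word of length \<open>n + 1\<close> in \<open>M\<^sub>k\<close> describes a
  simple cycle in the quotient graph, hence is nonzero in its homology and does not lie in
  \<open>M\<^sub>k\<^sub>+\<^sub>1\<close>. So \<open>R\<^sub>i\<close> is contained in \<open>L\<^sub>i C\<close>, provided that this process can start, i.e. that
  \<open>M\<^sub>1\<close> meets the images of \<open>A\<close> and \<open>B\<close> only inside \<open>L\<^sub>i C\<close>. By compatibility
  \<open>A / \<xi>\<^sub>i A (\<xi>\<^sub>i\<^sub>+\<^sub>1 A \<inter> C)\<close> and \<open>B / \<xi>\<^sub>i\<^sub>+\<^sub>1 B\<close> admit a common overgroup in which they agree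
  on \<open>C\<close> and in which \<open>\<xi>\<^sub>i\<^sub>+\<^sub>1 A\<close> becomes central; this gives the claim for \<open>A\<close>, and the one for
  \<open>B\<close> is symmetric. Finally \<open>R\<^sub>i / L\<^sub>i\<close> is abelian because \<open>L\<^sub>i\<^sub>+\<^sub>1 \<inter> C = \<xi>\<^sub>i\<^sub>+\<^sub>1 A \<inter> C\<close>, and the
  groups \<open>L\<^sub>0 \<le> R\<^sub>0 \<le> L\<^sub>1 \<le> \<dots>\<close> form the required series.\<close>

section \<open>The universal property of the amalgamated product\<close>

lemma BijGroup_UNIV [simp]:
  "carrier (BijGroup UNIV) = {f. bij f}"
  "\<one>\<^bsub>BijGroup UNIV\<^esub> = id"
  "bij f \<Longrightarrow> bij g \<Longrightarrow> f \<otimes>\<^bsub>BijGroup UNIV\<^esub> g = f \<circ> g"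
  by (auto simp: BijGroup_def Bij_def compose_def fun_eq_iff)

text \<open>Bijectivity follows from the two hypotheses: \<open>\<tau>\<close> of the inverse
  element is a two-sided inverse of \<open>\<tau> x\<close>.\<close>

lemma hom_BijGroup_UNIV:
  assumes "group G" and one: "\<tau> \<one>\<^bsub>G\<^esub> = id"
    and mult: "\<And>x y. x \<in> carrier G \<Longrightarrow> y \<in> carrier G \<Longrightarrow> \<tau> (x \<otimes>\<^bsub>G\<^esub> y) = \<tau> x \<circ> \<tau> y"
  shows "\<tau> \<in> hom G (BijGroup UNIV)"
proof -
  interpret group G by fact
  have "bij (\<tau> x)" if "x \<in> carrier G" for x
  proof (rule o_bij)
    show "\<tau> (inv\<^bsub>G\<^esub> x) \<circ> \<tau> x = id" "\<tau> x \<circ> \<tau> (inv\<^bsub>G\<^esub> x) = id"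
      using that by (simp_all flip: mult one)
  qed
  then show ?thesis
    by (intro homI) (auto simp: mult)
qed

lemma (in group) normal_Inter:
  assumes "\<N> \<noteq> {}" and "\<And>N. N \<in> \<N> \<Longrightarrow> N \<lhd> G"
  shows "\<Inter>\<N> \<lhd> G"
proof (rule normal_invI)
  show "subgroup (\<Inter>\<N>) G"
    using assms by (intro subgroups_Inter) (auto intro: normal_imp_subgroup)
qed (use assms in \<open>auto intro: normal.inv_op_closed2\<close>)

context group
begin

lemma normal_closure_normal:
  assumes "S \<subseteq> carrier G"
  shows "normal_closure G S \<lhd> G"
  unfolding normal_closure_def
  by (rule normal_Inter) (use assms normal_self in auto)

lemma normal_closure_incl: "S \<subseteq> normal_closure G S"
  by (auto simp: normal_closure_def)

lemma normal_closure_minimal: "N \<lhd> G \<Longrightarrow> S \<subseteq> N \<Longrightarrow> normal_closure G S \<subseteq> N"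
  by (auto simp: normal_closure_def)

end

section \<open>Evaluating words, and the universal property of the free product\<close>

definition fp_eval ::
    "('s, 'e) monoid_scheme \<Rightarrow> ('a \<Rightarrow> 's) \<Rightarrow> ('b \<Rightarrow> 's) \<Rightarrow> ('a + 'b) list \<Rightarrow> 's"
  where "fp_eval S h k w = foldr (\<lambda>x s. case_sum h k x \<otimes>\<^bsub>S\<^esub> s) w \<one>\<^bsub>S\<^esub>"

lemma fp_eval_simps [simp]:
  "fp_eval S h k [] = \<one>\<^bsub>S\<^esub>"
  "fp_eval S h k (x # w) = case_sum h k x \<otimes>\<^bsub>S\<^esub> fp_eval S h k w"
  by (simp_all add: fp_eval_def)

context
  fixes A :: "('a, 'c) monoid_scheme" and B :: "('b, 'd) monoid_scheme"
    and S :: "('s, 'e) monoid_scheme" and h k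
  assumes groups: "group A" "group B" "group S"
    and h: "h \<in> hom A S" and k: "k \<in> hom B S"
begin

interpretation A: group A by (fact groups)
interpretation B: group B by (fact groups)
interpretation S: group S by (fact groups)
interpretation h: group_hom A S h by unfold_locales (fact h)
interpretation k: group_hom B S k by unfold_locales (fact k)

lemma fp_eval_closed: "w \<in> fp_words A B \<Longrightarrow> fp_eval S h k w \<in> carrier S"
  by (induction w) (auto simp: fp_words_def split: sum.split)

lemma fp_eval_append:
  "v \<in> fp_words A B \<Longrightarrow> w \<in> fp_words A B \<Longrightarrow>
    fp_eval S h k (v @ w) = fp_eval S h k v \<otimes>\<^bsub>S\<^esub> fp_eval S h k w"
proof (induction v)
  case (Cons x v)
  then have "v \<in> fp_words A B" "case_sum h k x \<in> carrier S"
    by (auto simp: fp_words_def)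
  then show ?case
    using Cons by (simp add: S.m_assoc fp_eval_closed)
qed (simp add: fp_eval_closed)

lemma fp_eval_rel: "(v, w) \<in> fp_rel A B \<Longrightarrow> fp_eval S h k v = fp_eval S h k w"
  by (induction rule: fp_rel.induct)
    (simp_all add: fp_eval_append fp_eval_closed S.m_assoc[symmetric])

lemma free_product_universal:
  obtains f where "f \<in> hom (free_product A B) S"
    "\<And>a. a \<in> carrier A \<Longrightarrow> f (fp_inl A B a) = h a"
    "\<And>b. b \<in> carrier B \<Longrightarrow> f (fp_inr A B b) = k b"
proof
  let ?R = "fp_rel A B"
  \<comment> \<open>All words of a class have the same value by \<open>fp_eval_rel\<close>, so the
    image of a class is a singleton.\<close>
  define f where "f X = the_elem (fp_eval S h k ` X)" for X
  have f: "f (?R `` {w}) = fp_eval S h k w" if "w \<in> fp_words A B" for w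
  proof -
    have "fp_eval S h k ` (?R `` {w}) = {fp_eval S h k w}"
      using fp_rel.refl[OF that] by (fastforce dest: fp_eval_rel)
    then show ?thesis by (simp add: f_def)
  qed
  show "f \<in> hom (free_product A B) S"
  proof (rule homI)
    fix X Y assume "X \<in> carrier (free_product A B)" "Y \<in> carrier (free_product A B)"
    then obtain v w where vw: "v \<in> fp_words A B" "X = ?R `` {v}" "w \<in> fp_words A B" "Y = ?R `` {w}"
      using fp_carrier[OF groups(1,2)] by (auto elim!: quotientE)
    then show "f X \<in> carrier S"
      by (simp add: f fp_eval_closed)
    show "f (X \<otimes>\<^bsub>free_product A B\<^esub> Y) = f X \<otimes>\<^bsub>S\<^esub> f Y"
      using vw by (simp add: f fp_class_mult[OF groups(1,2)] fp_eval_append)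
  qed
  show "f (fp_inl A B a) = h a" if "a \<in> carrier A" for a
    using that f[of "[Inl a]"] by (simp add: fp_inl_def)
  show "f (fp_inr A B b) = k b" if "b \<in> carrier B" for b
    using that f[of "[Inr b]"] by (simp add: fp_inr_def)
qed

end

section \<open>The amalgamated product, its canonical maps and its universal property\<close>

locale amalgam = A: group A + B: group B
  for A :: "('a, 'c) monoid_scheme" and B :: "('b, 'd) monoid_scheme" +
  fixes C :: "'a set" and \<phi> :: "'a \<Rightarrow> 'b"
  assumes C: "subgroup C A" and \<phi>: "\<phi> \<in> hom (A\<lparr>carrier := C\<rparr>) B"
begin

abbreviation "F \<equiv> free_product A B"

abbreviation "G \<equiv> amalgamated_product A B C \<phi>"

definition "relators = {fp_inl A B c \<otimes>\<^bsub>F\<^esub> inv\<^bsub>F\<^esub> (fp_inr A B (\<phi> c)) | c. c \<in> C}"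

definition "\<alpha> a = normal_closure F relators #>\<^bsub>F\<^esub> fp_inl A B a"

definition "\<beta> b = normal_closure F relators #>\<^bsub>F\<^esub> fp_inr A B b"

lemma G_def: "G = F Mod normal_closure F relators"
  by (simp add: amalgamated_product_def relators_def Let_def)

sublocale F: group F
  by (rule group_free_product) unfold_locales

sublocale C: subgroup C A
  by (rule C)

sublocale \<phi>: group_hom "A\<lparr>carrier := C\<rparr>" B \<phi>
  using \<phi> by (simp add: group_hom_def group_hom_axioms_def B.group_axioms C.subgroup_is_group)

sublocale inl: group_hom A F "fp_inl A B"
  by unfold_locales (rule fp_inl_hom; unfold_locales)

sublocale inr: group_hom B F "fp_inr A B"
  by unfold_locales (rule fp_inr_hom; unfold_locales)

lemma \<phi>_closed: "c \<in> C \<Longrightarrow> \<phi> c \<in> carrier B"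
  using \<phi>.hom_closed by simp

lemma relators_carrier: "relators \<subseteq> carrier F"
  using \<phi>_closed by (auto simp: relators_def)

sublocale K: normal "normal_closure F relators" F
  using relators_carrier by (rule F.normal_closure_normal)

sublocale G: group G
  unfolding G_def by (rule K.factorgroup_is_group)

sublocale \<alpha>: group_hom A G \<alpha>
  using hom_compose[OF inl.homh K.r_coset_hom_Mod]
  by unfold_locales (simp add: \<alpha>_def[abs_def] G_def o_def)

sublocale \<beta>: group_hom B G \<beta>
  using hom_compose[OF inr.homh K.r_coset_hom_Mod]
  by unfold_locales (simp add: \<beta>_def[abs_def] G_def o_def)

lemma \<alpha>_eq_\<beta>:
  assumes "c \<in> C"
  shows "\<alpha> c = \<beta> (\<phi> c)"
proof -
  have "fp_inl A B c \<otimes>\<^bsub>F\<^esub> inv\<^bsub>F\<^esub> (fp_inr A B (\<phi> c)) \<in> normal_closure F relators"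
    using assms F.normal_closure_incl[of relators] by (auto simp: relators_def)
  then show ?thesis
    unfolding \<alpha>_def \<beta>_def using assms \<phi>_closed
    by (intro F.repr_independence[OF K.rcos_module_rev[OF F.group_axioms], symmetric]
        K.subgroup_axioms) auto
qed

text \<open>Induction on a representing word: its class is the class of the first letter, which
  comes from a factor, times the class of the rest.\<close>

lemma generate_\<alpha>_\<beta>: "generate G (\<alpha> ` carrier A \<union> \<beta> ` carrier B) = carrier G"
proof
  show "generate G (\<alpha> ` carrier A \<union> \<beta> ` carrier B) \<subseteq> carrier G"
    by (rule G.generate_incl) auto
  interpret q: group_hom F G "\<lambda>x. normal_closure F relators #>\<^bsub>F\<^esub> x"
    by unfold_locales (use K.r_coset_hom_Mod in \<open>simp add: G_def\<close>)
  have "normal_closure F relators #>\<^bsub>F\<^esub> (fp_rel A B `` {w})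
      \<in> generate G (\<alpha> ` carrier A \<union> \<beta> ` carrier B)" if "w \<in> fp_words A B" for w
    using that
  proof (induction w)
    case Nil
    show ?case
      using q.hom_one generate.one[of G] fp_one[OF A.group_axioms B.group_axioms] by metis
  next
    case (Cons x w)
    have w: "w \<in> fp_words A B" "[x] \<in> fp_words A B"
      using Cons.prems by (auto simp: fp_words_def)
    have carr: "fp_rel A B `` {v} \<in> carrier F" if "v \<in> fp_words A B" for v
      using that by (simp add: fp_carrier[OF A.group_axioms B.group_axioms] quotientI)
    have "normal_closure F relators #>\<^bsub>F\<^esub> (fp_rel A B `` {[x]})
      \<in> generate G (\<alpha> ` carrier A \<union> \<beta> ` carrier B)"
      using w by (cases x) (auto simp: \<alpha>_def \<beta>_def fp_inl_def fp_inr_def intro: generate.incl)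
    then show ?case
      using generate.eng[OF _ Cons.IH[OF w(1)]] q.hom_mult[OF carr[OF w(2)] carr[OF w(1)]]
        fp_class_mult[OF A.group_axioms B.group_axioms w(2,1)] by simp
  qed
  then show "carrier G \<subseteq> generate G (\<alpha> ` carrier A \<union> \<beta> ` carrier B)"
    by (auto simp: G_def carrier_FactGroup fp_carrier[OF A.group_axioms B.group_axioms]
        elim!: quotientE)
qed

text \<open>\<open>h\<close> and \<open>k\<close> extend to the free product; agreement on
  \<open>C\<close> puts the relators, and with them their normal closure, into the kernel, so the
  extension factors through \<open>G\<close>.\<close>

lemma universal:
  assumes S: "group S" and h: "h \<in> hom A S" and k: "k \<in> hom B S"
    and hk: "\<And>c. c \<in> C \<Longrightarrow> h c = k (\<phi> c)"
  obtains f where "f \<in> hom G S" "\<And>a. a \<in> carrier A \<Longrightarrow> f (\<alpha> a) = h a"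
    "\<And>b. b \<in> carrier B \<Longrightarrow> f (\<beta> b) = k b"
proof -
  obtain f0 where f0: "f0 \<in> hom F S"
    "\<And>a. a \<in> carrier A \<Longrightarrow> f0 (fp_inl A B a) = h a"
    "\<And>b. b \<in> carrier B \<Longrightarrow> f0 (fp_inr A B b) = k b"
    using free_product_universal[OF A.group_axioms B.group_axioms assms(1-3)] by blast
  interpret S: group S by fact
  interpret f0: group_hom F S f0 by unfold_locales (fact f0)
  have "relators \<subseteq> kernel F S f0"
    using \<phi>_closed hom_in_carrier[OF k] hk by (auto simp: relators_def kernel_def f0)
  then have "normal_closure F relators \<subseteq> kernel F S f0"
    by (intro F.normal_closure_minimal f0.normal_kernel)
  then obtain f where f: "f \<in> hom (F Mod normal_closure F relators) S"
    "\<And>x. x \<in> carrier F \<Longrightarrow> f (normal_closure F relators #>\<^bsub>F\<^esub> x) = f0 x"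
    using f0.FactGroup_universal_kernel[OF K.normal_axioms] by blast
  then show thesis
    by (intro that[of f]) (auto simp: G_def \<alpha>_def \<beta>_def f0)
qed

end

section \<open>Permutation representations of amalgams\<close>

text \<open>\<open>t\<close> picks a representative of each right coset of the image of
  \<open>h\<close>, and \<open>u\<close> a preimage of the remaining factor. As \<open>h\<close> may
  have a kernel, only the image of \<open>u y\<close> under \<open>h\<close> is determined.\<close>

lemma (in group_hom) coset_section:
  obtains t u where
    "\<And>y. y \<in> carrier H \<Longrightarrow> t y \<in> carrier H" "\<And>y. y \<in> carrier H \<Longrightarrow> u y \<in> carrier G"
    "\<And>y. y \<in> carrier H \<Longrightarrow> h (u y) \<otimes>\<^bsub>H\<^esub> t y = y"
    "\<And>x y. x \<in> carrier G \<Longrightarrow> y \<in> carrier H \<Longrightarrow> t (h x \<otimes>\<^bsub>H\<^esub> y) = t y"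
proof -
  let ?D = "h ` carrier G"
  interpret D: subgroup ?D H by (rule img_is_subgroup)
  \<comment> \<open>The choice is made from the coset as a set, so all elements of a coset get the
    same representative.\<close>
  define t where "t y = (SOME z. z \<in> ?D #>\<^bsub>H\<^esub> y)" for y
  have t: "t y \<in> ?D #>\<^bsub>H\<^esub> y" if "y \<in> carrier H" for y
    unfolding t_def by (rule someI[of _ y]) (rule H.rcos_self[OF that D.subgroup_axioms])
  have carr: "t y \<in> carrier H" if "y \<in> carrier H" for y
    using t[OF that] D.elemrcos_carrier[OF H.group_axioms] that by blast
  have "\<exists>x\<in>carrier G. h x \<otimes>\<^bsub>H\<^esub> t y = y" if y: "y \<in> carrier H" for y
  proof -
    obtain x where "x \<in> carrier G" "t y = h x \<otimes>\<^bsub>H\<^esub> y"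
      using t[OF y] by (auto simp: r_coset_def)
    then show ?thesis
      using y by (intro bexI[of _ "inv\<^bsub>G\<^esub> x"]) (simp_all add: H.m_assoc[symmetric])
  qed
  then obtain u where u: "\<And>y. y \<in> carrier H \<Longrightarrow> u y \<in> carrier G \<and> h (u y) \<otimes>\<^bsub>H\<^esub> t y = y"
    by metis
  have "t (h x \<otimes>\<^bsub>H\<^esub> y) = t y" if "x \<in> carrier G" "y \<in> carrier H" for x y
  proof -
    have "?D #>\<^bsub>H\<^esub> (h x \<otimes>\<^bsub>H\<^esub> y) = ?D #>\<^bsub>H\<^esub> y"
      using that D.rcos_const[OF H.group_axioms, of "h x"]
      by (simp flip: H.coset_mult_assoc[OF D.subset])
    then show ?thesis by (simp add: t_def)
  qed
  then show thesis
    by (intro that[of t u]) (simp_all add: carr u)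
qed

text \<open>The representation behind the normal form theorem, without words: \<open>P\<close> and \<open>Q\<close> act on
  \<open>P \<times> Q\<close> by left multiplication on their own coordinate. Writing \<open>x = f d t\<close> and \<open>y = g e s\<close>
  with coset representatives \<open>t\<close>, \<open>s\<close>, the involution that exchanges \<open>d\<close> and \<open>e\<close> intertwines
  the two resulting actions of \<open>D\<close>; conjugating the action of \<open>Q\<close> by it makes them equal.\<close>

lemma amalgam_faithful_representation:
  assumes f: "group_hom D P f" and g: "group_hom D Q g"
    and ker: "\<And>d. d \<in> carrier D \<Longrightarrow> f d = \<one>\<^bsub>P\<^esub> \<longleftrightarrow> g d = \<one>\<^bsub>Q\<^esub>"
  obtains i :: "'p \<Rightarrow> 'p \<times> 'q \<Rightarrow> 'p \<times> 'q" and j where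
    "i \<in> hom (P :: ('p, 'pe) monoid_scheme) (BijGroup UNIV)"
    "j \<in> hom (Q :: ('q, 'qe) monoid_scheme) (BijGroup UNIV)"
    "\<And>p. p \<in> carrier P \<Longrightarrow> i p = id \<Longrightarrow> p = \<one>\<^bsub>P\<^esub>"
    "\<And>q. q \<in> carrier Q \<Longrightarrow> j q = id \<Longrightarrow> q = \<one>\<^bsub>Q\<^esub>"
    "\<And>d. d \<in> carrier D \<Longrightarrow> i (f d) = j (g d)"
proof -
  interpret f: group_hom D P f by fact
  interpret g: group_hom D Q g by fact
  \<comment> \<open>By equality of the kernels, an identity between \<open>f\<close>-images of
    elements of \<open>D\<close> transfers to their \<open>g\<close>-images, and conversely.\<close>
  have same: "f d = f e \<longleftrightarrow> g d = g e" if "d \<in> carrier D" "e \<in> carrier D" for d e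
  proof -
    have "f d = f e \<longleftrightarrow> f (d \<otimes>\<^bsub>D\<^esub> inv\<^bsub>D\<^esub> e) = \<one>\<^bsub>P\<^esub>" "g d = g e \<longleftrightarrow> g (d \<otimes>\<^bsub>D\<^esub> inv\<^bsub>D\<^esub> e) = \<one>\<^bsub>Q\<^esub>"
      using that by (auto simp: f.H.inv_solve_right' g.H.inv_solve_right')
    then show ?thesis
      using that ker[of "d \<otimes>\<^bsub>D\<^esub> inv\<^bsub>D\<^esub> e"] by simp
  qed
  obtain t u where tu:
    "\<And>y. y \<in> carrier P \<Longrightarrow> t y \<in> carrier P" "\<And>y. y \<in> carrier P \<Longrightarrow> u y \<in> carrier D"
    "\<And>y. y \<in> carrier P \<Longrightarrow> f (u y) \<otimes>\<^bsub>P\<^esub> t y = y"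
    "\<And>x y. x \<in> carrier D \<Longrightarrow> y \<in> carrier P \<Longrightarrow> t (f x \<otimes>\<^bsub>P\<^esub> y) = t y"
    by (rule f.coset_section) (rule that)
  obtain s v where sv:
    "\<And>y. y \<in> carrier Q \<Longrightarrow> s y \<in> carrier Q" "\<And>y. y \<in> carrier Q \<Longrightarrow> v y \<in> carrier D"
    "\<And>y. y \<in> carrier Q \<Longrightarrow> g (v y) \<otimes>\<^bsub>Q\<^esub> s y = y"
    "\<And>x y. x \<in> carrier D \<Longrightarrow> y \<in> carrier Q \<Longrightarrow> s (g x \<otimes>\<^bsub>Q\<^esub> y) = s y"
    by (rule g.coset_section) (rule that)
  have tt: "t (t x) = t x" if "x \<in> carrier P" for x
    using tu(4)[of "u x" "t x"] tu(1-3)[OF that] by simp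
  have ss: "s (s x) = s x" if "x \<in> carrier Q" for x
    using sv(4)[of "v x" "s x"] sv(1-3)[OF that] by simp
  have fu: "f (u (f d \<otimes>\<^bsub>P\<^esub> x)) = f d \<otimes>\<^bsub>P\<^esub> f (u x)" if "d \<in> carrier D" "x \<in> carrier P" for d x
  proof -
    have "f (u (f d \<otimes>\<^bsub>P\<^esub> x)) \<otimes>\<^bsub>P\<^esub> t x = (f d \<otimes>\<^bsub>P\<^esub> f (u x)) \<otimes>\<^bsub>P\<^esub> t x"
      using that tu(3)[of "f d \<otimes>\<^bsub>P\<^esub> x"] by (simp add: tu f.H.m_assoc)
    then show ?thesis
      using that by (simp add: tu)
  qed
  then have gu: "g (u (f d \<otimes>\<^bsub>P\<^esub> x)) = g d \<otimes>\<^bsub>Q\<^esub> g (u x)"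
    if "d \<in> carrier D" "x \<in> carrier P" for d x
    using that same[of "u (f d \<otimes>\<^bsub>P\<^esub> x)" "d \<otimes>\<^bsub>D\<^esub> u x"] by (simp add: tu)
  have gv: "g (v (g d \<otimes>\<^bsub>Q\<^esub> x)) = g d \<otimes>\<^bsub>Q\<^esub> g (v x)" if "d \<in> carrier D" "x \<in> carrier Q" for d x
  proof -
    have "g (v (g d \<otimes>\<^bsub>Q\<^esub> x)) \<otimes>\<^bsub>Q\<^esub> s x = (g d \<otimes>\<^bsub>Q\<^esub> g (v x)) \<otimes>\<^bsub>Q\<^esub> s x"
      using that sv(3)[of "g d \<otimes>\<^bsub>Q\<^esub> x"] by (simp add: sv g.H.m_assoc)
    then show ?thesis
      using that by (simp add: sv)
  qed
  then have fv: "f (v (g d \<otimes>\<^bsub>Q\<^esub> x)) = f d \<otimes>\<^bsub>P\<^esub> f (v x)"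
    if "d \<in> carrier D" "x \<in> carrier Q" for d x
    using that same[of "v (g d \<otimes>\<^bsub>Q\<^esub> x)" "d \<otimes>\<^bsub>D\<^esub> v x"] by (simp add: sv)
  have ut: "f (u (t x)) = \<one>\<^bsub>P\<^esub>" if "x \<in> carrier P" for x
    using tu(3)[of "t x"] that by (simp add: tu tt)
  then have gut: "g (u (t x)) = \<one>\<^bsub>Q\<^esub>" if "x \<in> carrier P" for x
    using ker that by (simp add: tu)
  have vs: "g (v (s x)) = \<one>\<^bsub>Q\<^esub>" if "x \<in> carrier Q" for x
    using sv(3)[of "s x"] that by (simp add: sv ss)
  then have fvs: "f (v (s x)) = \<one>\<^bsub>P\<^esub>" if "x \<in> carrier Q" for x
    using ker that by (simp add: sv)
  let ?X = "carrier P \<times> carrier Q"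
  \<comment> \<open>\<open>T\<close> keeps the two coset representatives and exchanges the
    \<open>D\<close>-parts, read in the other group. Outside
    \<open>carrier P \<times> carrier Q\<close> it and both actions are the identity, so that they
    permute the whole type.\<close>
  define T where "T z = (if z \<in> ?X
    then (f (v (snd z)) \<otimes>\<^bsub>P\<^esub> t (fst z), g (u (fst z)) \<otimes>\<^bsub>Q\<^esub> s (snd z)) else z)" for z
  define i where "i p z = (if z \<in> ?X then (p \<otimes>\<^bsub>P\<^esub> fst z, snd z) else z)" for p z
  define r where "r q z = (if z \<in> ?X then (fst z, q \<otimes>\<^bsub>Q\<^esub> snd z) else z)" for q z
  have TT: "T \<circ> T = id"
    by (auto simp: fun_eq_iff T_def tu sv tt ss fu gv gu fv ut vs gut fvs)
  have Ti: "T \<circ> i (f d) = r (g d) \<circ> T" if "d \<in> carrier D" for d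
    using that by (auto simp: fun_eq_iff T_def i_def r_def tu sv gu g.H.m_assoc)
  define j where "j q = T \<circ> r q \<circ> T" for q
  show thesis
  proof (rule that[of i j])
    show "i \<in> hom P (BijGroup UNIV)"
      by (rule hom_BijGroup_UNIV) (auto simp: i_def fun_eq_iff f.H.m_assoc)
    show "j \<in> hom Q (BijGroup UNIV)"
    proof (rule hom_BijGroup_UNIV)
      have "r \<one>\<^bsub>Q\<^esub> = id" by (auto simp: r_def fun_eq_iff)
      then show "j \<one>\<^bsub>Q\<^esub> = id" by (simp add: j_def TT)
      fix x y assume "x \<in> carrier Q" "y \<in> carrier Q"
      then have "r (x \<otimes>\<^bsub>Q\<^esub> y) = r x \<circ> r y"
        by (auto simp: r_def fun_eq_iff g.H.m_assoc)
      moreover have "T (T z) = z" for z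
        using fun_cong[OF TT] by simp
      ultimately show "j (x \<otimes>\<^bsub>Q\<^esub> y) = j x \<circ> j y"
        by (simp add: j_def o_def)
    qed unfold_locales
    \<comment> \<open>Left multiplication is faithful, as its value at the base point
      \<open>(\<one>, \<one>)\<close> shows.\<close>
    show "p = \<one>\<^bsub>P\<^esub>" if "p \<in> carrier P" "i p = id" for p
      using that(1) fun_cong[OF that(2), of "(\<one>\<^bsub>P\<^esub>, \<one>\<^bsub>Q\<^esub>)"] by (simp add: i_def)
    show "q = \<one>\<^bsub>Q\<^esub>" if "q \<in> carrier Q" "j q = id" for q
    proof -
      have "r q = T \<circ> j q \<circ> T"
        using fun_cong[OF TT] by (simp add: j_def fun_eq_iff)
      then have "r q = id"
        by (simp add: that(2) TT)
      show ?thesis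
        using that(1) fun_cong[OF \<open>r q = id\<close>, of "(\<one>\<^bsub>P\<^esub>, \<one>\<^bsub>Q\<^esub>)"] by (simp add: r_def)
    qed
    show "i (f d) = j (g d)" if "d \<in> carrier D" for d
    proof -
      have "j (g d) = T \<circ> (r (g d) \<circ> T)"
        by (simp only: j_def o_assoc)
      also have "\<dots> = T \<circ> T \<circ> i (f d)"
        by (simp only: Ti[OF that, symmetric] o_assoc)
      finally show ?thesis
        by (simp add: TT)
    qed
  qed unfold_locales
qed

lemma (in normal) r_coset_eq_iff:
  assumes "x \<in> carrier G"
  shows "H #> x = H \<longleftrightarrow> x \<in> H"
  using assms rcos_self[OF assms subgroup_axioms] coset_join2[OF assms subgroup_axioms] by auto

lemma (in normal) r_coset_group_hom: "group_hom G (G Mod H) (\<lambda>x. H #> x)"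
  using r_coset_hom_Mod factorgroup_is_group
  by (simp add: group_hom_def group_hom_axioms_def group_axioms)

lemma (in group_hom) commute_if_commutator_in_kernel:
  assumes "x \<in> carrier G" "y \<in> carrier G"
    and "h (x \<otimes> y \<otimes> inv x \<otimes> inv y) = \<one>\<^bsub>H\<^esub>"
  shows "h x \<otimes>\<^bsub>H\<^esub> h y = h y \<otimes>\<^bsub>H\<^esub> h x"
proof -
  have "(h x \<otimes>\<^bsub>H\<^esub> h y) \<otimes>\<^bsub>H\<^esub> (inv\<^bsub>H\<^esub> h x \<otimes>\<^bsub>H\<^esub> inv\<^bsub>H\<^esub> h y) = \<one>\<^bsub>H\<^esub>"
    using assms by (simp add: H.m_assoc)
  from H.inv_equality[OF this] show ?thesis
    using assms(1,2) by (simp add: H.inv_mult_group)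
qed

text \<open>A conjugate of \<open>n\<close> by \<open>x\<close> is the commutator of
  \<open>x\<close> and \<open>n\<close>, which lies in \<open>U\<close> and so in \<open>N\<close>,
  times \<open>n\<close>.\<close>

lemma (in group) normal_between_commutators:
  assumes N: "subgroup N G" and "U \<subseteq> N" "N \<subseteq> Z"
    and comm: "\<And>x z. x \<in> carrier G \<Longrightarrow> z \<in> Z \<Longrightarrow> x \<otimes> z \<otimes> inv x \<otimes> inv z \<in> U"
  shows "N \<lhd> G"
proof (rule normal_invI[OF N])
  fix x n assume x: "x \<in> carrier G" and n: "n \<in> N"
  interpret N: subgroup N G by fact
  have "x \<otimes> n \<otimes> inv x = (x \<otimes> n \<otimes> inv x \<otimes> inv n) \<otimes> n"
    using x n by (simp add: m_assoc)
  also have "\<dots> \<in> N"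
    using comm[OF x, of n] n assms(2,3) by blast
  finally show "x \<otimes> n \<otimes> inv x \<in> N" .
qed

text \<open>With \<open>N = U (f D \<inter> Z)\<close>, amalgamate \<open>A / N\<close> and \<open>B / W \<times> Z / N\<close> along \<open>D \<times> Z\<close>; the second
  factor makes \<open>Z\<close> commute with \<open>B\<close>.\<close>

lemma amalgam_separating_representation:
  fixes A :: "('a, 'c) monoid_scheme" and B :: "('b, 'd) monoid_scheme"
  assumes f: "group_hom D A f" and g: "group_hom D B g"
    and U: "U \<lhd> A" and Z: "Z \<lhd> A" and UZ: "U \<subseteq> Z" and W: "W \<lhd> B"
    and comm: "\<And>x z. x \<in> carrier A \<Longrightarrow> z \<in> Z \<Longrightarrow>
      x \<otimes>\<^bsub>A\<^esub> z \<otimes>\<^bsub>A\<^esub> inv\<^bsub>A\<^esub> x \<otimes>\<^bsub>A\<^esub> inv\<^bsub>A\<^esub> z \<in> U"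
    and same: "\<And>d. d \<in> carrier D \<Longrightarrow> f d \<in> Z \<longleftrightarrow> g d \<in> W"
  obtains h :: "'a \<Rightarrow> 'a set \<times> 'b set \<times> 'a set \<Rightarrow> 'a set \<times> 'b set \<times> 'a set" and k
  where "h \<in> hom A (BijGroup UNIV)" "k \<in> hom B (BijGroup UNIV)"
    "\<And>d. d \<in> carrier D \<Longrightarrow> h (f d) = k (g d)"
    "\<And>a. a \<in> carrier A \<Longrightarrow> h a = id \<Longrightarrow> a \<in> U <#>\<^bsub>A\<^esub> (f ` carrier D \<inter> Z)"
    "\<And>u. u \<in> U \<Longrightarrow> h u = id" "\<And>w. w \<in> W \<Longrightarrow> k w = id"
    "\<And>z a. z \<in> Z \<Longrightarrow> a \<in> carrier A \<Longrightarrow> h z \<circ> h a = h a \<circ> h z"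
    "\<And>z b. z \<in> Z \<Longrightarrow> b \<in> carrier B \<Longrightarrow> h z \<circ> k b = k b \<circ> h z"
proof -
  interpret f: group_hom D A f by fact
  interpret g: group_hom D B g by fact
  interpret U: normal U A by fact
  interpret Z: normal Z A by fact
  interpret W: normal W B by fact
  define N where "N = U <#>\<^bsub>A\<^esub> (f ` carrier D \<inter> Z)"
  interpret E: subgroup "f ` carrier D \<inter> Z" A
    using f.img_is_subgroup Z.subgroup_axioms by (rule f.H.subgroups_Inter_pair)
  have N: "u \<otimes>\<^bsub>A\<^esub> e \<in> N" if "u \<in> U" "e \<in> f ` carrier D \<inter> Z" for u e
    using that unfolding N_def set_mult_def by blast
  have UN: "U \<subseteq> N"
    using N[OF _ E.one_closed] by auto
  have EN: "f d \<in> N" if "d \<in> carrier D" "f d \<in> Z" for d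
    using N[OF U.one_closed, of "f d"] that by simp
  have NZ: "N \<subseteq> Z"
    using UZ by (auto simp: N_def set_mult_def)
  have "subgroup N A"
    unfolding N_def by (rule f.H.mult_norm_subgroup[OF U E.subgroup_axioms])
  then interpret N: normal N A
    using UN NZ comm by (rule f.H.normal_between_commutators)
  let ?\<pi> = "\<lambda>a. N #>\<^bsub>A\<^esub> a" and ?\<rho> = "\<lambda>b. W #>\<^bsub>B\<^esub> b"
  interpret \<pi>: group_hom A "A Mod N" ?\<pi> by (rule N.r_coset_group_hom)
  interpret \<rho>: group_hom B "B Mod W" ?\<rho> by (rule W.r_coset_group_hom)
  \<comment> \<open>Commutators with \<open>Z\<close> vanish already modulo \<open>U\<close>, so
    \<open>Z\<close> becomes central in \<open>A Mod N\<close>; this makes \<open>?f\<close> below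
    multiplicative.\<close>
  have \<pi>_comm: "?\<pi> x \<otimes>\<^bsub>A Mod N\<^esub> ?\<pi> z = ?\<pi> z \<otimes>\<^bsub>A Mod N\<^esub> ?\<pi> x" if "x \<in> carrier A" "z \<in> Z" for x z
  proof (rule \<pi>.commute_if_commutator_in_kernel)
    have "x \<otimes>\<^bsub>A\<^esub> z \<otimes>\<^bsub>A\<^esub> inv\<^bsub>A\<^esub> x \<otimes>\<^bsub>A\<^esub> inv\<^bsub>A\<^esub> z \<in> N"
      using comm[OF that] UN by blast
    then show "N #>\<^bsub>A\<^esub> (x \<otimes>\<^bsub>A\<^esub> z \<otimes>\<^bsub>A\<^esub> inv\<^bsub>A\<^esub> x \<otimes>\<^bsub>A\<^esub> inv\<^bsub>A\<^esub> z) = \<one>\<^bsub>A Mod N\<^esub>"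
      using N.r_coset_eq_iff by simp
  qed (use that in auto)
  let ?Q = "(B Mod W) \<times>\<times> (A Mod N)" and ?D = "D \<times>\<times> A\<lparr>carrier := Z\<rparr>"
  interpret D: group ?D
    by (intro DirProd_group f.G.group_axioms Z.subgroup_is_group f.H.group_axioms)
  interpret Q: group ?Q
    by (intro DirProd_group \<rho>.H.group_axioms \<pi>.H.group_axioms)
  let ?f = "\<lambda>(d, z). ?\<pi> (f d \<otimes>\<^bsub>A\<^esub> z)" and ?g = "\<lambda>(d, z). (?\<rho> (g d), ?\<pi> z)"
  have f': "group_hom ?D (A Mod N) ?f"
  proof (unfold_locales, rule homI)
    fix x y assume "x \<in> carrier ?D" "y \<in> carrier ?D"
    moreover obtain d z e w where "x = (d, z)" "y = (e, w)"
      by (metis surj_pair)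
    ultimately have *: "x = (d, z)" "y = (e, w)" "d \<in> carrier D" "z \<in> Z" "e \<in> carrier D" "w \<in> Z"
      by auto
    show "?f x \<in> carrier (A Mod N)"
      using * \<pi>.hom_closed[of "f d \<otimes>\<^bsub>A\<^esub> z"] by simp
    have "?\<pi> (f d) \<otimes>\<^bsub>A Mod N\<^esub> ((?\<pi> (f e) \<otimes>\<^bsub>A Mod N\<^esub> ?\<pi> z) \<otimes>\<^bsub>A Mod N\<^esub> ?\<pi> w)
        = ?\<pi> (f d) \<otimes>\<^bsub>A Mod N\<^esub> ((?\<pi> z \<otimes>\<^bsub>A Mod N\<^esub> ?\<pi> (f e)) \<otimes>\<^bsub>A Mod N\<^esub> ?\<pi> w)"
      using * by (simp only: \<pi>_comm f.hom_closed)
    then have "?\<pi> (f d \<otimes>\<^bsub>A\<^esub> ((f e \<otimes>\<^bsub>A\<^esub> z) \<otimes>\<^bsub>A\<^esub> w)) = ?\<pi> (f d \<otimes>\<^bsub>A\<^esub> ((z \<otimes>\<^bsub>A\<^esub> f e) \<otimes>\<^bsub>A\<^esub> w))"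
      using * by (simp only: \<pi>.hom_mult f.hom_closed Z.mem_carrier f.H.m_closed)
    then have "?\<pi> ((f d \<otimes>\<^bsub>A\<^esub> f e) \<otimes>\<^bsub>A\<^esub> (z \<otimes>\<^bsub>A\<^esub> w)) = ?\<pi> ((f d \<otimes>\<^bsub>A\<^esub> z) \<otimes>\<^bsub>A\<^esub> (f e \<otimes>\<^bsub>A\<^esub> w))"
      using * by (simp only: f.H.m_assoc f.hom_closed Z.mem_carrier f.H.m_closed)
    also have "\<dots> = ?\<pi> (f d \<otimes>\<^bsub>A\<^esub> z) \<otimes>\<^bsub>A Mod N\<^esub> ?\<pi> (f e \<otimes>\<^bsub>A\<^esub> w)"
      by (rule \<pi>.hom_mult) (use * in auto)
    finally show "?f (x \<otimes>\<^bsub>?D\<^esub> y) = ?f x \<otimes>\<^bsub>A Mod N\<^esub> ?f y"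
      using * by simp
  qed
  have g': "group_hom ?D ?Q ?g"
    by (unfold_locales, rule homI)
      (auto simp del: mult_FactGroup intro: \<pi>.hom_closed \<rho>.hom_closed)
  have ker: "?f x = \<one>\<^bsub>A Mod N\<^esub> \<longleftrightarrow> ?g x = \<one>\<^bsub>?Q\<^esub>" if xD: "x \<in> carrier ?D" for x
  proof -
    obtain d z where x: "x = (d, z)" "d \<in> carrier D" "z \<in> Z"
      using xD by auto
    \<comment> \<open>This matches the two kernels. A product in \<open>N\<close>, hence in
      \<open>Z\<close>, forces \<open>f d\<close> into \<open>Z\<close> and so into
      \<open>N\<close>; and \<open>same\<close> turns \<open>f d\<close> in \<open>Z\<close> into
      \<open>g d\<close> in \<open>W\<close>.\<close>
    have "f d \<otimes>\<^bsub>A\<^esub> z \<in> N \<longleftrightarrow> f d \<in> Z \<and> z \<in> N"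
    proof
      assume *: "f d \<otimes>\<^bsub>A\<^esub> z \<in> N"
      then have "f d \<otimes>\<^bsub>A\<^esub> z \<otimes>\<^bsub>A\<^esub> inv\<^bsub>A\<^esub> z \<in> Z"
        using NZ x(3) by blast
      then have "f d \<in> Z"
        using x by (simp add: f.H.m_assoc)
      moreover have "inv\<^bsub>A\<^esub> f d \<otimes>\<^bsub>A\<^esub> (f d \<otimes>\<^bsub>A\<^esub> z) \<in> N"
        using * EN[OF x(2) \<open>f d \<in> Z\<close>] by blast
      ultimately show "f d \<in> Z \<and> z \<in> N"
        using x by (simp flip: f.H.m_assoc)
    qed (use EN x(2) in blast)
    then show ?thesis
      using x same by (simp add: N.r_coset_eq_iff W.r_coset_eq_iff del: \<pi>.hom_mult)
  qed
  obtain i j where i: "i \<in> hom (A Mod N) (BijGroup UNIV)"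
    and j: "j \<in> hom ?Q (BijGroup (UNIV :: ('a set \<times> 'b set \<times> 'a set) set))"
    and inj: "\<And>p. p \<in> carrier (A Mod N) \<Longrightarrow> i p = id \<Longrightarrow> p = \<one>\<^bsub>A Mod N\<^esub>"
    and ij: "\<And>d. d \<in> carrier ?D \<Longrightarrow> i (?f d) = j (?g d)"
    by (rule amalgam_faithful_representation[OF f' g' ker]) (assumption, rule that)
  interpret S: group "BijGroup (UNIV :: ('a set \<times> 'b set \<times> 'a set) set)"
    by (rule group_BijGroup)
  interpret i: group_hom "A Mod N" "BijGroup UNIV" i
    by unfold_locales (rule i)
  interpret j: group_hom ?Q "BijGroup UNIV" j
    by unfold_locales (rule j)
  have bij: "bij (i (?\<pi> a))" if "a \<in> carrier A" for a
    using i.hom_closed[OF \<pi>.hom_closed[OF that]] by simp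
  \<comment> \<open>With trivial \<open>D\<close>-part, the identification along \<open>?D\<close>
    says that elements of \<open>Z\<close> act through the second factor of \<open>?Q\<close>. This
    is why they commute with \<open>B\<close>, which acts through the first.\<close>
  have ia: "i (?\<pi> a) = j (W, ?\<pi> a)" if "a \<in> Z" for a
    using ij[of "(\<one>\<^bsub>D\<^esub>, a)"] that by simp
  have Q: "(?\<rho> b, N) \<in> carrier ?Q" if "b \<in> carrier B" for b
    using that \<rho>.hom_closed \<pi>.H.one_closed by simp
  have bj: "bij (j (?\<rho> b, N))" if "b \<in> carrier B" for b
    using j.hom_closed[OF Q[OF that]] by simp
  \<comment> \<open>In the pairs, \<open>N\<close> and \<open>W\<close> stand for the identities of
    \<open>A Mod N\<close> and \<open>B Mod W\<close>.\<close>
  show thesis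
  proof (rule that[of "\<lambda>a. i (?\<pi> a)" "\<lambda>b. j (?\<rho> b, N)"])
    show "(\<lambda>a. i (?\<pi> a)) \<in> hom A (BijGroup UNIV)"
      using hom_compose[OF \<pi>.homh i] by (simp add: o_def)
    have "(\<lambda>b. (?\<rho> b, N)) \<in> hom B ?Q"
      using \<rho>.hom_mult \<pi>.H.one_closed \<pi>.H.l_one[OF \<pi>.H.one_closed]
      by (intro homI) (auto simp del: mult_FactGroup \<pi>.H.l_one intro: \<rho>.hom_closed)
    from hom_compose[OF this j] show "(\<lambda>b. j (?\<rho> b, N)) \<in> hom B (BijGroup UNIV)"
      by (simp add: o_def)
    show "i (?\<pi> (f d)) = j (?\<rho> (g d), N)" if "d \<in> carrier D" for d
      using ij[of "(d, \<one>\<^bsub>A\<^esub>)"] that by (simp add: N.subset)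
    show "a \<in> U <#>\<^bsub>A\<^esub> (f ` carrier D \<inter> Z)" if "a \<in> carrier A" "i (?\<pi> a) = id" for a
      using inj[OF \<pi>.hom_closed[OF that(1)] that(2)] N.r_coset_eq_iff[OF that(1)]
      by (simp add: N_def)
    show "i (?\<pi> u) = id" if "u \<in> U" for u
      using that UN N.r_coset_eq_iff[of u] i.hom_one by auto
    show "j (?\<rho> w, N) = id" if "w \<in> W" for w
      using that W.r_coset_eq_iff[of w] j.hom_one by auto
    show "i (?\<pi> z) \<circ> i (?\<pi> a) = i (?\<pi> a) \<circ> i (?\<pi> z)" if "z \<in> Z" "a \<in> carrier A" for z a
      using that bij arg_cong[OF \<pi>_comm[OF that(2,1)], of i]
      by (simp add: i.hom_mult \<pi>.hom_closed del: mult_FactGroup)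
    show "i (?\<pi> z) \<circ> j (?\<rho> b, N) = j (?\<rho> b, N) \<circ> i (?\<pi> z)" if "z \<in> Z" "b \<in> carrier B" for z b
    proof -
      have *: "(W, ?\<pi> z) \<in> carrier ?Q"
        using that \<pi>.hom_closed \<rho>.H.one_closed by simp
      have "(W, ?\<pi> z) \<otimes>\<^bsub>?Q\<^esub> (?\<rho> b, N) = (?\<rho> b, N) \<otimes>\<^bsub>?Q\<^esub> (W, ?\<pi> z)"
        using that \<rho>.H.l_one[OF \<rho>.hom_closed, of b] \<rho>.H.r_one[OF \<rho>.hom_closed, of b]
          \<pi>.H.l_one[OF \<pi>.hom_closed, of z] \<pi>.H.r_one[OF \<pi>.hom_closed, of z] by simp
      from arg_cong[OF this, of j] show ?thesis
        using j.hom_mult[OF * Q[OF that(2)]] j.hom_mult[OF Q[OF that(2)] *]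
          ia[OF that(1)] bij[of z] bj[OF that(2)] that(1) by simp
    qed
  qed
qed

section \<open>The upper central series\<close>

text \<open>Turns centrality in the quotient into a condition on commutators in \<open>G\<close>,
  the form in which the central series is used later.\<close>

lemma (in normal) r_coset_in_center_iff:
  assumes x: "x \<in> carrier G"
  shows "H #> x \<in> center (G Mod H) \<longleftrightarrow> (\<forall>y \<in> carrier G. y \<otimes> x \<otimes> inv y \<otimes> inv x \<in> H)"
proof -
  interpret q: group_hom G "G Mod H" "\<lambda>x. H #> x" by (rule r_coset_group_hom)
  have "(H #> x) \<otimes>\<^bsub>G Mod H\<^esub> (H #> y) = (H #> y) \<otimes>\<^bsub>G Mod H\<^esub> (H #> x) \<longleftrightarrow>
      y \<otimes> x \<otimes> inv y \<otimes> inv x \<in> H" (is "?c \<longleftrightarrow> _") if y: "y \<in> carrier G" for y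
  proof -
    have "y \<otimes> x \<otimes> inv y \<otimes> inv x = (y \<otimes> x) \<otimes> inv (x \<otimes> y)"
      using x y by (simp add: inv_mult_group m_assoc)
    then have "y \<otimes> x \<otimes> inv y \<otimes> inv x \<in> H \<longleftrightarrow> H #> (x \<otimes> y) = H #> (y \<otimes> x)"
      using x y rcos_module[OF is_group, of "x \<otimes> y" "y \<otimes> x"]
        repr_independence[OF _ _ subgroup_axioms, of "y \<otimes> x" "x \<otimes> y"]
        rcos_self[OF _ subgroup_axioms, of "y \<otimes> x"] by auto
    then show ?thesis
      using x y q.hom_mult by simp
  qed
  then show ?thesis
    using x by (auto simp: center_def carrier_FactGroup q.hom_closed)
qed

lemma (in group) center_subgroup: "subgroup (center G) G"
proof (rule subgroupI)
  have "\<one> \<in> center G" by (simp add: center_def)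
  then show "center G \<noteq> {}" by blast
next
  fix a assume a: "a \<in> center G"
  have "inv a \<otimes> x = x \<otimes> inv a" if x: "x \<in> carrier G" for x
  proof -
    have aG: "a \<in> carrier G" and ax: "a \<otimes> x = x \<otimes> a" using a x by (auto simp: center_def)
    have "inv a \<otimes> x = inv a \<otimes> (x \<otimes> a) \<otimes> inv a"
      using aG x by (simp add: m_assoc)
    also have "\<dots> = x \<otimes> inv a"
      using aG x by (simp flip: ax m_assoc)
    finally show ?thesis .
  qed
  then show "inv a \<in> center G" using a unfolding center_def by blast
next
  fix a b assume ab: "a \<in> center G" "b \<in> center G"
  have "a \<otimes> b \<otimes> x = x \<otimes> (a \<otimes> b)" if x: "x \<in> carrier G" for x
  proof -
    have carr: "a \<in> carrier G" "b \<in> carrier G" and comm: "a \<otimes> x = x \<otimes> a" "b \<otimes> x = x \<otimes> b"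
      using ab x by (auto simp: center_def)
    have "a \<otimes> b \<otimes> x = a \<otimes> x \<otimes> b"
      using carr x by (simp add: m_assoc comm(2))
    also have "\<dots> = x \<otimes> (a \<otimes> b)"
      using carr x by (simp only: comm(1) m_assoc)
    finally show ?thesis .
  qed
  then show "a \<otimes> b \<in> center G" using ab unfolding center_def by blast
qed (auto simp: center_def)

lemma (in group_hom) subgroup_preimage:
  assumes "subgroup K H"
  shows "subgroup {x \<in> carrier G. h x \<in> K} G"
proof -
  interpret K: subgroup K H by fact
  have "\<one> \<in> {x \<in> carrier G. h x \<in> K}" by simp
  then show ?thesis by (intro G.subgroupI) auto
qed

text \<open>This is the preimage of the center of \<open>G Mod H\<close>. It contains
  \<open>H\<close>, and its commutators with \<open>G\<close> fall into \<open>H\<close>, so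
  \<open>normal_between_commutators\<close> applies with the set itself as upper bound.\<close>

lemma (in normal) center_preimage_normal:
  "{x \<in> carrier G. \<forall>y\<in>carrier G. y \<otimes> x \<otimes> inv y \<otimes> inv x \<in> H} \<lhd> G" (is "?Z \<lhd> G")
proof -
  interpret q: group_hom G "G Mod H" "\<lambda>x. H #> x" by (rule r_coset_group_hom)
  have "?Z = {x \<in> carrier G. H #> x \<in> center (G Mod H)}"
    using r_coset_in_center_iff by auto
  then have "subgroup ?Z G"
    using q.subgroup_preimage[OF q.H.center_subgroup] by simp
  moreover have "H \<subseteq> ?Z"
    by (auto intro: inv_op_closed2)
  ultimately show ?thesis
    by (rule normal_between_commutators[OF _ _ order_refl]) blast
qed

lemma (in group) upper_central_normal: "upper_central G i \<lhd> G"
proof (induction i)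
  case (Suc i)
  interpret N: normal "upper_central G i" G by (rule Suc.IH)
  have "upper_central G (Suc i) =
      {x \<in> carrier G. \<forall>y\<in>carrier G. y \<otimes> x \<otimes> inv y \<otimes> inv x \<in> upper_central G i}"
    using N.r_coset_in_center_iff by auto
  then show ?case
    using N.center_preimage_normal by simp
qed (simp add: one_is_normal)

lemma (in group) upper_central_commutator:
  assumes "x \<in> carrier G" "z \<in> upper_central G (Suc i)"
  shows "x \<otimes> z \<otimes> inv x \<otimes> inv z \<in> upper_central G i"
  using assms normal.r_coset_in_center_iff[OF upper_central_normal, of z i] by simp

lemma (in group) upper_central_Suc: "upper_central G i \<subseteq> upper_central G (Suc i)"
proof
  interpret N: normal "upper_central G i" G by (rule upper_central_normal)
  fix x assume x: "x \<in> upper_central G i"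
  then have "upper_central G i #> x \<in> center (G Mod upper_central G i)"
    by (subst N.r_coset_in_center_iff) (auto intro: N.inv_op_closed2)
  then show "x \<in> upper_central G (Suc i)" using x by simp
qed

lemma (in group) upper_central_mono: "i \<le> j \<Longrightarrow> upper_central G i \<subseteq> upper_central G j"
  by (rule lift_Suc_mono_le[of "upper_central G"]) (rule upper_central_Suc)

section \<open>Iterated commutators and girth\<close>

text \<open>For normal \<open>L\<close> and \<open>M\<close> this is \<open>[M, M] L\<close>; taking
  the normal closure gives normality by construction and lets upper bounds be checked on
  generators.\<close>

definition (in group) commutator_step :: "'a set \<Rightarrow> 'a set \<Rightarrow> 'a set"
  where "commutator_step L M = normal_closure G (derived G M \<union> L)"

context group
begin

lemma commutator_step_normal:
  assumes "L \<subseteq> carrier G" "M \<subseteq> carrier G"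
  shows "commutator_step L M \<lhd> G"
  unfolding commutator_step_def using assms derived_in_carrier by (intro normal_closure_normal) auto

lemma commutator_step_incl: "derived G M \<subseteq> commutator_step L M" "L \<subseteq> commutator_step L M"
  using normal_closure_incl[of "derived G M \<union> L"] by (auto simp: commutator_step_def)

lemma commutator_step_minimal:
  assumes "N \<lhd> G" "M \<subseteq> carrier G" and "L \<subseteq> N"
    and comm: "\<And>x y. x \<in> M \<Longrightarrow> y \<in> M \<Longrightarrow> x \<otimes> y \<otimes> inv x \<otimes> inv y \<in> N"
  shows "commutator_step L M \<subseteq> N"
  unfolding commutator_step_def
proof (rule normal_closure_minimal[OF assms(1)])
  have "derived G M \<subseteq> N"
    unfolding derived_def
    by (rule generate_subgroup_incl[OF _ normal_imp_subgroup[OF assms(1)]]) (use comm in auto)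
  then show "derived G M \<union> L \<subseteq> N" using assms(3) by blast
qed

lemma commutator_step_subset:
  assumes "M \<lhd> G" "L \<subseteq> M"
  shows "commutator_step L M \<subseteq> M"
proof -
  interpret M: normal M G by fact
  show ?thesis
    using assms by (intro commutator_step_minimal M.subset) auto
qed

lemma subgroup_mult_left_iff:
  assumes "subgroup H G" "h \<in> H" "x \<in> carrier G"
  shows "h \<otimes> x \<in> H \<longleftrightarrow> x \<in> H"
proof -
  interpret H: subgroup H G by fact
  have "h \<otimes> x \<in> H \<Longrightarrow> inv h \<otimes> (h \<otimes> x) \<in> H" using assms by blast
  then show ?thesis using assms by (auto simp: m_assoc[symmetric])
qed

lemma subgroup_mult_right_iff:
  assumes "subgroup H G" "h \<in> H" "x \<in> carrier G"
  shows "x \<otimes> h \<in> H \<longleftrightarrow> x \<in> H"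
proof -
  interpret H: subgroup H G by fact
  have "x \<otimes> h \<in> H \<Longrightarrow> (x \<otimes> h) \<otimes> inv h \<in> H" using assms by blast
  then show ?thesis using assms by (auto simp: m_assoc)
qed

text \<open>The rule \<open>generate.eng\<close> multiplies two arbitrary elements, so the induction
  proves the stronger claim that \<open>g\<close> maps \<open>X\<close> into itself. Closure of
  \<open>S\<close> under inverses lets one condition on \<open>X\<close> cover both kinds of
  generators.\<close>

lemma generate_induct_mult_left:
  assumes S: "S \<subseteq> carrier G" "\<And>s. s \<in> S \<Longrightarrow> inv s \<in> S"
    and X: "X \<subseteq> carrier G" "\<one> \<in> X" "\<And>s x. s \<in> S \<Longrightarrow> x \<in> X \<Longrightarrow> s \<otimes> x \<in> X"
  shows "generate G S \<subseteq> X"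
proof
  fix g assume g: "g \<in> generate G S"
  then have "\<forall>x \<in> X. g \<otimes> x \<in> X"
  proof (induction rule: generate.induct)
    case (eng g h)
    have "g \<in> carrier G" "h \<in> carrier G"
      using eng.hyps generate_in_carrier[OF S(1)] by auto
    then show ?case
      using eng.IH X(1) by (auto simp: m_assoc subset_iff)
  qed (use S X in auto)
  then have "g \<otimes> \<one> \<in> X" using X(2) by blast
  then show "g \<in> X"
    using generate_in_carrier[OF S(1) g] by simp
qed

end

text \<open>A group \<open>G\<close> generated by subgroups \<open>P\<close>, \<open>Q\<close> with a common subgroup \<open>D\<close>, together with the only
  consequence of being their amalgamated product that the girth argument uses: in terms of the tree
  of cosets, \<open>c g x\<close> counts with signs, and weighted by \<open>f\<close>, the edges crossed by \<open>g\<close> from base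
  point \<open>x\<close>.\<close>

locale amalgam_crossing = group G for G (structure) +
  fixes P Q D :: "'a set"
  assumes P: "subgroup P G" and Q: "subgroup Q G" and D: "subgroup D G"
    and DP: "D \<subseteq> P" and DQ: "D \<subseteq> Q"
    and generate_PQ: "generate G (P \<union> Q) = carrier G"
    and crossing: "\<And>f :: 'a \<Rightarrow> int. (\<And>d x. d \<in> D \<Longrightarrow> x \<in> carrier G \<Longrightarrow> f (d \<otimes> x) = f x) \<Longrightarrow>
      \<exists>c. (\<forall>g\<in>carrier G. \<forall>h\<in>carrier G. \<forall>x\<in>carrier G. c (g \<otimes> h) x = c g (h \<otimes> x) + c h x) \<and>
        (\<forall>p\<in>P. \<forall>x\<in>carrier G. c p x = 0) \<and>
        (\<forall>q\<in>Q. \<forall>x\<in>carrier G. c q x = f (q \<otimes> x) - f x)"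
begin

section \<open>Reduced words over the two factors\<close>

sublocale P: subgroup P G by (rule P)
sublocale Q: subgroup Q G by (rule Q)
sublocale D: subgroup D G by (rule D)

text \<open>The flag \<open>s\<close> tells whether the first letter comes from \<open>P\<close> or
  from \<open>Q\<close>; then the factors alternate. The excluded set \<open>H\<close> will be
  \<open>L <#> D\<close>, so that words are reduced even modulo \<open>L\<close>.\<close>

primrec reduced :: "'a set \<Rightarrow> bool \<Rightarrow> 'a list \<Rightarrow> bool" where
  "reduced H s [] \<longleftrightarrow> True"
| "reduced H s (x # xs) \<longleftrightarrow> x \<in> (if s then P else Q) \<and> x \<notin> H \<and> reduced H (\<not> s) xs"

primrec word_prod :: "'a list \<Rightarrow> 'a" where
  "word_prod [] = \<one>"
| "word_prod (x # xs) = x \<otimes> word_prod xs"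

lemma reduced_carrier: "reduced H s xs \<Longrightarrow> set xs \<subseteq> carrier G"
  by (induction xs arbitrary: s) (auto split: if_splits)

lemma word_prod_closed [simp]: "set xs \<subseteq> carrier G \<Longrightarrow> word_prod xs \<in> carrier G"
  by (induction xs) auto

lemma word_prod_append:
  "set xs \<subseteq> carrier G \<Longrightarrow> set ys \<subseteq> carrier G \<Longrightarrow> word_prod (xs @ ys) = word_prod xs \<otimes> word_prod ys"
  by (induction xs) (auto simp: m_assoc)

lemma reduced_prefix: "reduced H s (xs @ ys) \<Longrightarrow> reduced H s xs"
  by (induction xs arbitrary: s) auto

text \<open>A lower bound for the girth of the quotient graph: a reduced word with product in
  \<open>M <#> D\<close> leads from the edge \<open>D\<close> back to itself modulo
  \<open>M\<close>.\<close>

definition avoids :: "'a set \<Rightarrow> nat \<Rightarrow> 'a set \<Rightarrow> bool"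
  where "avoids H n M \<longleftrightarrow>
    (\<forall>s xs. reduced H s xs \<longrightarrow> xs \<noteq> [] \<longrightarrow> length xs \<le> n \<longrightarrow> word_prod xs \<notin> M <#> D)"

section \<open>Normal forms and girth modulo a normal subgroup \<open>L\<close>\<close>

context
  fixes L H
  assumes L: "L \<lhd> G" and L_gen: "L \<subseteq> normal_closure G (L \<inter> (P \<union> Q))"
    and H: "H = L <#> D"
begin

interpretation L: normal L G by (rule L)

lemma H_subgroup: "subgroup H G"
  unfolding H using L D by (rule mult_norm_subgroup)

interpretation H: subgroup H G by (rule H_subgroup)

lemma DH: "D \<subseteq> H"
proof
  fix d assume "d \<in> D"
  then have "\<one> \<otimes> d \<in> H" unfolding H set_mult_def using L.one_closed by blast
  then show "d \<in> H" using \<open>d \<in> D\<close> by simp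
qed

text \<open>\<open>D\<close> lies in both factors and in \<open>H\<close>, so multiplying the first
  letter by \<open>d\<close> changes neither its factor nor its being outside
  \<open>H\<close>.\<close>

lemma reduced_absorb_left:
  assumes "reduced H s xs" "xs \<noteq> []" "d \<in> D"
  obtains ys where "reduced H s ys" "ys \<noteq> []" "word_prod ys = d \<otimes> word_prod xs"
proof (cases xs)
  case (Cons x xs')
  have x: "x \<in> carrier G" "set xs' \<subseteq> carrier G"
    using reduced_carrier[OF assms(1)] Cons by auto
  have "d \<otimes> x \<notin> H"
    using assms Cons DH subgroup_mult_left_iff[OF H_subgroup, of d x] x by auto
  moreover have "d \<otimes> x \<in> (if s then P else Q)"
    using assms Cons DP DQ by auto
  ultimately show thesis
    using assms Cons x by (intro that[of "(d \<otimes> x) # xs'"]) (auto simp: m_assoc)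
qed (use assms in simp)

text \<open>The last letter absorbs \<open>d\<close>. The length is recorded because the girth
  argument counts letters.\<close>

lemma reduced_absorb_right:
  assumes "reduced H s xs" "xs \<noteq> []" "d \<in> D"
  shows "\<exists>ys. reduced H s ys \<and> length ys = length xs \<and> word_prod ys = word_prod xs \<otimes> d"
  using assms(1,2)
proof (induction xs arbitrary: s)
  case (Cons x xs)
  have x: "x \<in> carrier G" "set xs \<subseteq> carrier G"
    using reduced_carrier[OF Cons.prems(1)] by auto
  show ?case
  proof (cases "xs = []")
    case True
    have "x \<otimes> d \<notin> H"
      using assms(3) Cons.prems DH subgroup_mult_right_iff[OF H_subgroup, of d x] x by auto
    moreover have "x \<otimes> d \<in> (if s then P else Q)"
      using assms(3) Cons.prems DP DQ by auto
    ultimately show ?thesis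
      using True x assms(3) by (intro exI[of _ "[x \<otimes> d]"]) auto
  next
    case False
    then obtain ys where "reduced H (\<not> s) ys" "length ys = length xs" "word_prod ys = word_prod xs \<otimes> d"
      using Cons by auto
    then show ?thesis
      using Cons.prems x assms(3) by (intro exI[of _ "x # ys"]) (auto simp: m_assoc)
  qed
qed simp

definition normal_forms :: "'a set"
  where "normal_forms = H \<union> {l \<otimes> word_prod xs | l s xs. l \<in> L \<and> reduced H s xs \<and> xs \<noteq> []}"

lemma normal_formsI: "l \<in> L \<Longrightarrow> reduced H s xs \<Longrightarrow> xs \<noteq> [] \<Longrightarrow> l \<otimes> word_prod xs \<in> normal_forms"
  unfolding normal_forms_def by blast

lemma normal_swap:
  assumes "x \<in> carrier G" "l \<in> L"
  obtains l' where "l' \<in> L" "x \<otimes> l = l' \<otimes> x"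
  using assms L.inv_op_closed2[OF assms] by (intro that[of "x \<otimes> l \<otimes> inv x"]) (auto simp: m_assoc)

text \<open>With \<open>h = l \<otimes> d\<close>, the parts in \<open>L\<close> move to the front
  by normality, and the first letter absorbs \<open>d\<close>.\<close>

lemma normal_forms_H_mult:
  assumes h: "h \<in> H" and g: "g \<in> normal_forms"
  shows "h \<otimes> g \<in> normal_forms"
proof -
  obtain l d where ld: "h = l \<otimes> d" "l \<in> L" "d \<in> D"
    using h by (auto simp: H set_mult_def)
  from g consider "g \<in> H" | k s xs where "g = k \<otimes> word_prod xs" "k \<in> L" "reduced H s xs" "xs \<noteq> []"
    unfolding normal_forms_def by blast
  then show ?thesis
  proof cases
    case 1
    then show ?thesis using h by (simp add: normal_forms_def)
  next
    case (2 k s xs)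
    obtain k' where k': "k' \<in> L" "d \<otimes> k = k' \<otimes> d"
      using normal_swap[of d k] ld 2 by auto
    obtain ys where ys: "reduced H s ys" "ys \<noteq> []" "word_prod ys = d \<otimes> word_prod xs"
      using reduced_absorb_left[OF 2(3,4) ld(3)] by blast
    have "word_prod xs \<in> carrier G" using reduced_carrier[OF 2(3)] by simp
    then have "h \<otimes> g = l \<otimes> (d \<otimes> k) \<otimes> word_prod xs"
      using ld 2 by (simp add: m_assoc)
    also have "\<dots> = (l \<otimes> k') \<otimes> word_prod ys"
      using \<open>word_prod xs \<in> carrier G\<close> ld k' ys by (simp add: m_assoc)
    also have "\<dots> \<in> normal_forms"
      using ld k' ys by (intro normal_formsI) auto
    finally show ?thesis .
  qed
qed

text \<open>A letter outside \<open>H\<close> is prepended to a word starting in the other factor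
  and merged with the first letter otherwise. If the merged letter lies in \<open>H\<close>, the
  word gets shorter and \<open>normal_forms_H_mult\<close> absorbs that letter into the
  rest.\<close>

lemma normal_forms_letter_mult:
  assumes y: "y \<in> (if t then P else Q)" and g: "g \<in> normal_forms"
  shows "y \<otimes> g \<in> normal_forms"
proof (cases "y \<in> H")
  case True
  then show ?thesis using g by (rule normal_forms_H_mult)
next
  case yH: False
  have yG: "y \<in> carrier G" using y by (auto split: if_splits)
  from g consider "g \<in> H" | k s x xs where "g = k \<otimes> word_prod (x # xs)" "k \<in> L" "reduced H s (x # xs)"
    unfolding normal_forms_def by (auto simp: neq_Nil_conv)
  then show ?thesis
  proof cases
    case 1
    then obtain l d where ld: "g = l \<otimes> d" "l \<in> L" "d \<in> D"
      by (auto simp: H set_mult_def)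
    obtain l' where l': "l' \<in> L" "y \<otimes> l = l' \<otimes> y"
      using normal_swap[of y l] ld yG by auto
    have "y \<otimes> d \<notin> H"
      using ld DH yH subgroup_mult_right_iff[OF H_subgroup, of d y] yG by auto
    moreover have "y \<otimes> d \<in> (if t then P else Q)"
      using ld y DP DQ by (auto split: if_splits)
    ultimately have "l' \<otimes> word_prod [y \<otimes> d] \<in> normal_forms"
      using l' by (intro normal_formsI[of _ t]) auto
    moreover have "y \<otimes> g = l' \<otimes> word_prod [y \<otimes> d]"
      using ld l' yG by (simp add: m_assoc[symmetric])
    ultimately show ?thesis by simp
  next
    case (2 k s x xs)
    obtain k' where k': "k' \<in> L" "y \<otimes> k = k' \<otimes> y"
      using normal_swap[of y k] 2 yG by auto
    have x: "x \<in> carrier G" "set xs \<subseteq> carrier G" "word_prod xs \<in> carrier G"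
      using reduced_carrier[OF 2(3)] by auto
    have eq: "y \<otimes> g = k' \<otimes> (y \<otimes> (x \<otimes> word_prod xs))"
    proof -
      have "y \<otimes> g = (y \<otimes> k) \<otimes> (x \<otimes> word_prod xs)"
        using 2 x yG by (simp add: m_assoc)
      then show ?thesis using k' x yG by (simp add: m_assoc)
    qed
    show ?thesis
    proof (cases "s = t")
      case False
      then have "reduced H t (y # x # xs)" using 2(3) y yH by auto
      from normal_formsI[OF k'(1) this] show ?thesis using eq by simp
    next
      case True
      have yx: "y \<otimes> x \<in> (if t then P else Q)"
        using y 2(3) True by (auto split: if_splits)
      show ?thesis
      proof (cases "y \<otimes> x \<in> H")
        case False
        then have "reduced H t ((y \<otimes> x) # xs)" using 2(3) True yx by auto
        from normal_formsI[OF k'(1) this] show ?thesis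
          using eq x yG k' by (simp add: m_assoc)
      next
        case yxH: True
        have "\<one> \<otimes> word_prod xs \<in> normal_forms"
        proof (cases "xs = []")
          case True
          then show ?thesis by (simp add: normal_forms_def)
        next
          case False
          then show ?thesis using 2(3) by (intro normal_formsI[of _ "\<not> s"]) auto
        qed
        have "k' \<otimes> (y \<otimes> x) \<in> H"
        proof -
          have "k' \<otimes> \<one> \<in> H" unfolding H set_mult_def using k' D.one_closed by blast
          then show ?thesis using yxH k' by auto
        qed
        from normal_forms_H_mult[OF this \<open>\<one> \<otimes> word_prod xs \<in> normal_forms\<close>]
        have "(k' \<otimes> (y \<otimes> x)) \<otimes> (\<one> \<otimes> word_prod xs) \<in> normal_forms" .
        then show ?thesis using eq x yG k' by (simp add: m_assoc)
      qed
    qed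
  qed
qed

lemma carrier_subset_normal_forms: "carrier G \<subseteq> normal_forms"
proof -
  have "generate G (P \<union> Q) \<subseteq> normal_forms"
  proof (rule generate_induct_mult_left)
    show "normal_forms \<subseteq> carrier G"
      unfolding normal_forms_def using reduced_carrier by fastforce
    show "\<one> \<in> normal_forms" by (simp add: normal_forms_def)
    show "s \<otimes> x \<in> normal_forms" if "s \<in> P \<union> Q" "x \<in> normal_forms" for s x
      using that normal_forms_letter_mult[of s True x] normal_forms_letter_mult[of s False x] by auto
  qed auto
  then show ?thesis by (simp add: generate_PQ)
qed

text \<open>For the base point inverse to the word without its first letter, only the first two letters
  of a shortest word contribute to the crossing number; exactly one of them counts, being in \<open>Q\<close>,
  so the crossing number is \<open>1\<close> or \<open>-1\<close>.\<close>

lemma avoids_commutator_step: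
  assumes M: "M \<lhd> G" and LM: "L \<subseteq> M" and n: "n \<ge> 1" and av: "avoids H n M"
  shows "avoids H (Suc n) (commutator_step L M)"
proof -
  interpret M: normal M G by fact
  let ?M' = "commutator_step L M"
  interpret M': normal ?M' G
    by (rule commutator_step_normal[OF L.subset M.subset])
  have M'M: "?M' \<subseteq> M" using commutator_step_subset[OF M LM] .
  have MD: "subgroup (M <#> D) G" using M D by (rule mult_norm_subgroup)
  then interpret MD: subgroup "M <#> D" G .
  have in_MD: "m \<otimes> d \<in> M <#> D" if "m \<in> M" "d \<in> D" for m d
    using that unfolding set_mult_def by blast
  have M_sub: "m \<in> M <#> D" if "m \<in> M" for m using in_MD[OF that D.one_closed] that by simp
  have D_sub: "d \<in> M <#> D" if "d \<in> D" for d using in_MD[OF M.one_closed that] that by simp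
  \<comment> \<open>With this indicator as weight, \<open>c\<close> counts signed passages of the
    single edge \<open>M <#> D\<close> of the quotient graph.\<close>
  define f :: "'a \<Rightarrow> int" where "f x = (if x \<in> M <#> D then 1 else 0)" for x
  have fD: "f (d \<otimes> x) = f x" if "d \<in> D" "x \<in> carrier G" for d x
    using subgroup_mult_left_iff[OF MD D_sub] that by (simp add: f_def)
  have fM: "f (x \<otimes> m) = f x" if "m \<in> M" "x \<in> carrier G" for m x
    using subgroup_mult_right_iff[OF MD M_sub] that by (simp add: f_def)
  from crossing[of f, OF fD] obtain c where
    c_mult: "\<And>g h x. g \<in> carrier G \<Longrightarrow> h \<in> carrier G \<Longrightarrow> x \<in> carrier G \<Longrightarrow>
      c (g \<otimes> h) x = c g (h \<otimes> x) + c h x"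
    and cP: "\<And>p x. p \<in> P \<Longrightarrow> x \<in> carrier G \<Longrightarrow> c p x = 0"
    and cQ: "\<And>q x. q \<in> Q \<Longrightarrow> x \<in> carrier G \<Longrightarrow> c q x = f (q \<otimes> x) - f x"
    by blast
  have c1: "c \<one> x = 0" if "x \<in> carrier G" for x
    using c_mult[of \<one> \<one> x] that by simp
  \<comment> \<open>Crossing numbers depend on the base point only modulo \<open>M\<close>. By the
    product rule it suffices to check single letters, where this is the invariance of
    \<open>f\<close>.\<close>
  have cM: "c g (x \<otimes> m) = c g x" if "g \<in> carrier G" "x \<in> carrier G" "m \<in> M" for g x m
  proof -
    have "generate G (P \<union> Q) \<subseteq> {g \<in> carrier G. \<forall>x\<in>carrier G. c g (x \<otimes> m) = c g x}" (is "_ \<subseteq> ?X")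
    proof (rule generate_induct_mult_left)
      show "\<one> \<in> ?X" using that c1 by simp
      show "s \<otimes> y \<in> ?X" if s: "s \<in> P \<union> Q" and y: "y \<in> ?X" for s y
      proof -
        have sX: "c s (x \<otimes> m) = c s x" if "x \<in> carrier G" for x
          using s that \<open>m \<in> M\<close> fM[OF \<open>m \<in> M\<close>, of x] fM[OF \<open>m \<in> M\<close>, of "s \<otimes> x"]
          by (auto simp: cP cQ m_assoc)
        have "s \<in> carrier G" using s by auto
        then have "c (s \<otimes> y) (x \<otimes> m) = c (s \<otimes> y) x" if "x \<in> carrier G" for x
          using that y \<open>m \<in> M\<close> sX[of "y \<otimes> x"] by (simp add: c_mult m_assoc)
        then show ?thesis using \<open>s \<in> carrier G\<close> y by simp
      qed
    qed auto
    then show ?thesis using that generate_PQ by auto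
  qed
  have cM': "c g (m \<otimes> x) = c g x" if "g \<in> carrier G" "x \<in> carrier G" "m \<in> M" for g x m
  proof -
    have "m \<otimes> x = x \<otimes> (inv x \<otimes> m \<otimes> x)" using that by (simp add: m_assoc[symmetric])
    then show ?thesis using cM[of g x "inv x \<otimes> m \<otimes> x"] that M.inv_op_closed1 by simp
  qed
  \<comment> \<open>By \<open>cM'\<close> the crossing number is additive on \<open>M\<close> for
    each base point, hence a homomorphism to the integers. \<open>K\<close> is the common kernel, so
    it contains the commutators of \<open>M\<close>.\<close>
  define K where "K = {m \<in> M. \<forall>x\<in>carrier G. c m x = 0}"
  have "K \<lhd> G"
  proof (rule normal_invI)
    show "subgroup K G"
    proof (rule subgroupI)
      show "K \<subseteq> carrier G" by (auto simp: K_def)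
      have "\<one> \<in> K" by (simp add: K_def c1)
      then show "K \<noteq> {}" by blast
      show "a \<otimes> b \<in> K" if "a \<in> K" "b \<in> K" for a b
        using that by (simp add: K_def c_mult)
      show "inv a \<in> K" if "a \<in> K" for a
      proof -
        have "c (inv a) x = 0" if x: "x \<in> carrier G" for x
          using c_mult[of "inv a" a "inv a \<otimes> x"] c1[of "inv a \<otimes> x"] x \<open>a \<in> K\<close>
          by (simp add: K_def m_assoc[symmetric])
        then show ?thesis using that by (simp add: K_def)
      qed
    qed
    show "g \<otimes> k \<otimes> inv g \<in> K" if g: "g \<in> carrier G" and k: "k \<in> K" for g k
    proof -
      have kM: "k \<in> M" and k0: "\<And>x. x \<in> carrier G \<Longrightarrow> c k x = 0" using k by (auto simp: K_def)
      have "c (g \<otimes> k \<otimes> inv g) x = 0" if x: "x \<in> carrier G" for x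
      proof -
        have "c (g \<otimes> k \<otimes> inv g) x = c g (inv g \<otimes> x) + c (inv g) x"
          using g kM x k0[of "inv g \<otimes> x"] cM'[of g "inv g \<otimes> x" k] by (simp add: c_mult)
        also have "\<dots> = c (g \<otimes> inv g) x"
          using g x c_mult[of g "inv g" x] by simp
        finally show ?thesis using g x c1 by simp
      qed
      then show ?thesis using M.inv_op_closed2[OF g kM] by (simp add: K_def)
    qed
  qed
  then interpret K: normal K G .
  have "?M' \<subseteq> K"
  proof (rule commutator_step_minimal[OF \<open>K \<lhd> G\<close> M.subset])
    \<comment> \<open>Here the generation of \<open>L\<close> by its elements in the factors enters:
      such an element lies in \<open>M\<close>, so multiplying by it leaves \<open>f\<close>
      unchanged and its crossing number is zero.\<close>
    have "L \<inter> (P \<union> Q) \<subseteq> K"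
    proof
      fix l assume l: "l \<in> L \<inter> (P \<union> Q)"
      then have "l \<in> M" using LM by blast
      have "c l x = 0" if x: "x \<in> carrier G" for x
      proof -
        have "l \<otimes> x = x \<otimes> (inv x \<otimes> l \<otimes> x)" using x \<open>l \<in> M\<close> by (simp add: m_assoc[symmetric])
        then have "f (l \<otimes> x) = f x"
          using fM[of "inv x \<otimes> l \<otimes> x" x] x \<open>l \<in> M\<close> M.inv_op_closed1 by simp
        then show ?thesis using l x by (auto simp: cP cQ)
      qed
      then show "l \<in> K" using \<open>l \<in> M\<close> unfolding K_def by blast
    qed
    from normal_closure_minimal[OF \<open>K \<lhd> G\<close> this] show "L \<subseteq> K" using L_gen by blast
    show "a \<otimes> b \<otimes> inv a \<otimes> inv b \<in> K" if a: "a \<in> M" and b: "b \<in> M" for a b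
    proof -
      have add: "c (m \<otimes> m') x = c m x + c m' x" if "m \<in> M" "m' \<in> M" "x \<in> carrier G" for m m' x
        using that cM'[of m x m'] by (simp add: c_mult)
      have inv: "c (inv m) x = - c m x" if "m \<in> M" "x \<in> carrier G" for m x
        using add[of m "inv m" x] c1[of x] that by simp
      have "c (a \<otimes> b \<otimes> inv a \<otimes> inv b) x = 0" if "x \<in> carrier G" for x
        using a b that by (simp add: add inv)
      then show ?thesis using a b unfolding K_def by blast
    qed
  qed
  have c_M': "c g x = 0" if "g \<in> ?M'" "x \<in> carrier G" for g x
    using that \<open>?M' \<subseteq> K\<close> unfolding K_def by blast
  have f_inv: "f (inv (word_prod v)) = 0" if "reduced H s v" "v \<noteq> []" "length v \<le> n" for s v
  proof -
    have "word_prod v \<notin> M <#> D" using av that unfolding avoids_def by blast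
    moreover have "word_prod v \<in> carrier G" using reduced_carrier[OF that(1)] by simp
    ultimately have "inv (word_prod v) \<notin> M <#> D" using MD.m_inv_closed by fastforce
    then show ?thesis by (simp add: f_def)
  qed
  \<comment> \<open>Read from the right, the letters of \<open>u\<close> move the base point through
    inverses of products of nonempty prefixes of length at most \<open>n\<close>. \<open>f\<close>
    vanishes at all of them, so no letter contributes.\<close>
  have tail: "c (word_prod u) (inv (word_prod (v @ u))) = 0"
    if "reduced H s (v @ u)" "v \<noteq> []" "length (v @ u) \<le> n" for s v u
    using that
  proof (induction u arbitrary: v)
    case Nil
    then show ?case using reduced_carrier[OF Nil.prems(1)] by (simp add: c1)
  next
    case (Cons z u)
    have carr: "set v \<subseteq> carrier G" "z \<in> carrier G" "set u \<subseteq> carrier G"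
      using reduced_carrier[OF Cons.prems(1)] by auto
    let ?Y = "inv (word_prod (v @ z # u))"
    have IH: "c (word_prod u) ?Y = 0"
      using Cons.IH[of "v @ [z]"] Cons.prems by simp
    have v: "reduced H s v" using reduced_prefix[OF Cons.prems(1)] .
    have vz: "reduced H s (v @ [z])" using reduced_prefix[of H s "v @ [z]" u] Cons.prems(1) by simp
    have Yu: "word_prod u \<otimes> ?Y = inv (word_prod (v @ [z]))"
      using carr by (simp add: word_prod_append inv_mult_group m_assoc[symmetric])
    have zYu: "z \<otimes> inv (word_prod (v @ [z])) = inv (word_prod v)"
      using carr by (simp add: word_prod_append inv_mult_group m_assoc[symmetric])
    have zPQ: "z \<in> P \<union> Q"
      using Cons.prems(1) by (induction v arbitrary: s) (auto split: if_splits)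
    have "c z (inv (word_prod (v @ [z]))) = 0"
    proof (cases "z \<in> P")
      case True
      then show ?thesis using carr by (simp add: cP)
    next
      case False
      then have "c z (inv (word_prod (v @ [z]))) = f (inv (word_prod v)) - f (inv (word_prod (v @ [z])))"
        using zPQ carr zYu by (simp add: cQ)
      then show ?thesis using f_inv[OF v] f_inv[OF vz] Cons.prems by simp
    qed
    then show ?case
      using IH Yu carr c_mult[of z "word_prod u" ?Y] by simp
  qed
  show ?thesis
    unfolding avoids_def
  proof (intro allI impI notI)
    fix s xs assume xs: "reduced H s xs" "xs \<noteq> []" "length xs \<le> Suc n" "word_prod xs \<in> ?M' <#> D"
    then obtain m d where md: "word_prod xs = m \<otimes> d" "m \<in> ?M'" "d \<in> D"
      by (auto simp: set_mult_def)
    \<comment> \<open>Absorbing the inverse of \<open>d\<close> gives a word of the same length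
      whose product is \<open>m\<close> itself.\<close>
    obtain ys where ys: "reduced H s ys" "length ys = length xs" "word_prod ys = word_prod xs \<otimes> inv d"
      using reduced_absorb_right[OF xs(1,2), of "inv d"] md by auto
    have "word_prod ys = m" using ys md by (simp add: m_assoc)
    have "word_prod xs \<in> M <#> D" using md M'M in_MD by auto
    \<comment> \<open>Shorter words are excluded by \<open>av\<close>, because \<open>?M'\<close>
      lies in \<open>M\<close>. As \<open>n \<ge> 1\<close>, there are at least two letters to split
      off.\<close>
    then have "length xs = Suc n" using av xs unfolding avoids_def by (metis le_SucE)
    then obtain x y u where xyu: "ys = x # y # u"
      using ys(2) n by (cases ys; cases "tl ys") auto
    have carr: "x \<in> carrier G" "y \<in> carrier G" "set u \<subseteq> carrier G"
      using reduced_carrier[OF ys(1)] xyu by auto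
    let ?Y = "inv (word_prod (y # u))"
    have red: "reduced H (\<not> s) ([y] @ u)" "reduced H s [x]" "reduced H (\<not> s) [y]"
      using ys(1) xyu by auto
    have 1: "c (word_prod u) ?Y = 0"
      using tail[OF red(1)] \<open>length xs = Suc n\<close> ys(2) xyu by simp
    have 2: "word_prod u \<otimes> ?Y = inv y" "word_prod (y # u) \<otimes> ?Y = \<one>"
      using carr r_inv[of "word_prod (y # u)"]
      by (simp_all add: inv_mult_group m_assoc[symmetric] del: r_inv)
    have "c m ?Y = c x \<one> + c (y \<otimes> word_prod u) ?Y"
      using carr 2 c_mult[of x "word_prod (y # u)" ?Y] \<open>word_prod ys = m\<close> xyu by simp
    also have "c (y \<otimes> word_prod u) ?Y = c y (inv y)"
      using carr 1 2 c_mult[of y "word_prod u" ?Y] by simp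
    finally have "c x \<one> + c y (inv y) = 0"
      using c_M'[OF md(2), of ?Y] carr by simp
    moreover have "f \<one> = 1" by (simp add: f_def)
    moreover have "f (inv y) = 0" using f_inv[OF red(3)] n carr by simp
    moreover have "f x = 0"
      using av red(2) n carr unfolding avoids_def f_def by fastforce
    ultimately show False
      using red carr by (cases s) (auto simp: cP cQ)
  qed
qed

text \<open>If \<open>l \<otimes> w\<close> lies in every term and \<open>w\<close> is reduced of
  length \<open>k\<close>, then \<open>w\<close> lies in the \<open>k\<close>-th term since
  \<open>l\<close> does; but that term avoids reduced words of length \<open>k\<close>.\<close>

lemma Inter_commutator_steps_subset:
  assumes K: "K \<lhd> G" "L \<subseteq> K" and av: "avoids H 1 (commutator_step L K)"
  shows "(\<Inter>k. (commutator_step L ^^ k) K) \<subseteq> H"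
proof -
  let ?M = "\<lambda>k. (commutator_step L ^^ k) K"
  have normal: "?M k \<lhd> G" for k
  proof (induction k)
    case (Suc k)
    then show ?case
      using commutator_step_normal[OF L.subset subgroup.subset[OF normal_imp_subgroup]] by simp
  qed (simp add: K)
  have LM: "L \<subseteq> ?M k" for k
    by (cases k) (use K commutator_step_incl in auto)
  \<comment> \<open>The hypothesis \<open>av\<close> concerns term 1, since term 0 is
    \<open>K\<close> itself; from there each commutator step gains one letter.\<close>
  have avk: "avoids H (Suc k) (?M (Suc k))" for k
  proof (induction k)
    case (Suc k)
    from avoids_commutator_step[OF normal[of "Suc k"] LM _ Suc] show ?case by simp
  qed (use av in simp)
  show ?thesis
  proof
    fix g assume g: "g \<in> (\<Inter>k. ?M k)"
    then have "g \<in> ?M 0" by blast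
    then have "g \<in> K" by simp
    then have "g \<in> normal_forms"
      using carrier_subset_normal_forms subgroup.subset[OF normal_imp_subgroup[OF K(1)]] by blast
    then consider "g \<in> H" | l s xs where "g = l \<otimes> word_prod xs" "l \<in> L" "reduced H s xs" "xs \<noteq> []"
      unfolding normal_forms_def by blast
    then show "g \<in> H"
    proof cases
      case (2 l s xs)
      let ?k = "length xs"
      have k: "?k = Suc (?k - 1)" using 2(4) by (cases xs) auto
      interpret Mk: normal "?M ?k" G by (rule normal)
      have "g \<in> ?M ?k" "l \<in> ?M ?k" using g LM 2(2) by blast+
      moreover have "word_prod xs \<in> carrier G" using reduced_carrier[OF 2(3)] by simp
      ultimately have "word_prod xs \<in> ?M ?k"
        using 2(1) subgroup_mult_left_iff[OF Mk.subgroup_axioms] by simp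
      then have "word_prod xs \<otimes> \<one> \<in> ?M ?k <#> D"
        unfolding set_mult_def using D.one_closed by blast
      then have "word_prod xs \<in> ?M ?k <#> D" using \<open>word_prod xs \<in> carrier G\<close> by simp
      moreover have "avoids H ?k (?M ?k)" using avk[of "?k - 1"] by (simp only: k[symmetric])
      ultimately show ?thesis using 2 unfolding avoids_def by blast
    qed
  qed
qed

end

end

section \<open>Residually solvable quotients\<close>

text \<open>The projection to \<open>G Mod M\<close> factors through \<open>G Mod R\<close>, and
  \<open>G Mod M\<close> is solvable because its derived series is the image of that of
  \<open>G\<close>. Its type is not the one the definition asks for;
  \<open>residually_solvable_witness\<close> bridges this.\<close>

lemma (in group) residually_solvable_Mod:
  assumes R: "R \<lhd> G"
    and sep: "\<And>g. g \<in> carrier G \<Longrightarrow> g \<notin> R \<Longrightarrow>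
      \<exists>M n. M \<lhd> G \<and> R \<subseteq> M \<and> g \<notin> M \<and> (derived G ^^ n) (carrier G) \<subseteq> M"
  shows "residually_solvable (G Mod R)"
  unfolding residually_solvable_def
proof (intro ballI impI)
  interpret R: normal R G by fact
  fix X assume X: "X \<in> carrier (G Mod R)" "X \<noteq> \<one>\<^bsub>G Mod R\<^esub>"
  then obtain g where g: "g \<in> carrier G" "X = R #> g"
    by (auto simp: carrier_FactGroup)
  then have "g \<notin> R" using X(2) R.r_coset_eq_iff by simp
  then obtain M n where M: "M \<lhd> G" "R \<subseteq> M" "g \<notin> M" "(derived G ^^ n) (carrier G) \<subseteq> M"
    using sep g(1) by blast
  interpret M: normal M G by fact
  interpret q: group_hom G "G Mod M" "\<lambda>x. M #> x" by (rule M.r_coset_group_hom)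
  have "R \<subseteq> kernel G (G Mod M) (\<lambda>x. M #> x)"
    using M(2) by (simp add: kernel_def subset_iff M.r_coset_eq_iff)
  then obtain p where p: "p \<in> hom (G Mod R) (G Mod M)" "\<And>x. x \<in> carrier G \<Longrightarrow> p (R #> x) = M #> x"
    using q.FactGroup_universal_kernel[OF R] by blast
  have surj: "(\<lambda>x. M #> x) ` carrier G = carrier (G Mod M)"
    by (simp add: carrier_FactGroup)
  have "(derived (G Mod M) ^^ n) (carrier (G Mod M)) = (\<lambda>x. M #> x) ` ((derived G ^^ n) (carrier G))"
    unfolding surj[symmetric] by (rule q.exp_of_derived_img) simp
  also have "\<dots> \<subseteq> {\<one>\<^bsub>G Mod M\<^esub>}"
    using M(4) M.r_coset_eq_iff[OF M.mem_carrier] by (intro image_subsetI) (simp add: subset_iff)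
  finally have "(derived (G Mod M) ^^ n) (carrier (G Mod M)) = {\<one>\<^bsub>G Mod M\<^esub>}"
    using subgroup.one_closed[OF q.H.exp_of_derived_is_subgroup[OF q.H.subgroup_self, of n]] by blast
  then have "solvable (G Mod M)"
    using q.H.solvable_iff_trivial_derived_seq by blast
  moreover have "p ` carrier (G Mod R) = carrier (G Mod M)"
    using p(2) by (force simp: carrier_FactGroup)
  then have "p \<in> epi (G Mod R) (G Mod M)"
    using p(1) by (simp add: epi_def)
  moreover have "p X \<noteq> \<one>\<^bsub>G Mod M\<^esub>"
    using g p(2) M(3) M.r_coset_eq_iff by simp
  ultimately show "\<exists>(H :: 'a set set monoid) f.
      group H \<and> solvable H \<and> f \<in> epi (G Mod R) H \<and> f X \<noteq> \<one>\<^bsub>H\<^esub>"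
    using residually_solvable_witness[OF R.factorgroup_is_group M.factorgroup_is_group _ _ X(1)] by blast
qed

context group
begin

lemma commutator_steps_normal:
  assumes "L \<lhd> G" "K \<lhd> G"
  shows "(commutator_step L ^^ k) K \<lhd> G"
proof (induction k)
  case (Suc k)
  then show ?case
    using assms commutator_step_normal[OF subgroup.subset[OF normal_imp_subgroup]
      subgroup.subset[OF normal_imp_subgroup]] by simp
qed (simp add: assms)

lemma commutator_steps_incl: "L \<subseteq> K \<Longrightarrow> L \<subseteq> (commutator_step L ^^ k) K"
  by (cases k) (use commutator_step_incl in auto)

lemma commutator_steps_subset:
  assumes "L \<lhd> G" "K \<lhd> G" "L \<subseteq> K"
  shows "(commutator_step L ^^ k) K \<subseteq> K"
proof (induction k)
  case (Suc k)
  have "commutator_step L ((commutator_step L ^^ k) K) \<subseteq> (commutator_step L ^^ k) K"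
    using assms by (intro commutator_step_subset commutator_steps_normal commutator_steps_incl)
  then show ?case using Suc by auto
qed simp

lemma Inter_commutator_steps_normal:
  assumes "L \<lhd> G" "K \<lhd> G"
  shows "(\<Inter>k. (commutator_step L ^^ k) K) \<lhd> G"
  by (rule normal_Inter) (use commutator_steps_normal[OF assms] in auto)

text \<open>The \<open>k\<close>-th derived group of \<open>K\<close> lies in the
  \<open>k\<close>-th term, so every term has a solvable quotient in \<open>K\<close>, and an
  element outside the intersection is missed by some term.\<close>

lemma residually_solvable_Inter_commutator_steps:
  assumes L: "L \<lhd> G" and K: "K \<lhd> G" and LK: "L \<subseteq> K"
  shows "residually_solvable (G\<lparr>carrier := K\<rparr> Mod (\<Inter>k. (commutator_step L ^^ k) K))"
proof -
  let ?M = "\<lambda>k. (commutator_step L ^^ k) K" and ?K = "G\<lparr>carrier := K\<rparr>"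
  interpret K: normal K G by fact
  interpret H: group ?K by (rule K.subgroup_is_group[OF is_group])
  have MK: "?M k \<subseteq> K" for k using assms by (rule commutator_steps_subset)
  have norm: "X \<lhd> ?K" if "X \<lhd> G" "X \<subseteq> K" for X
    using that K.subgroup_axioms normal_restrict_supergroup by blast
  have derived: "(derived ?K ^^ k) K \<subseteq> ?M k" for k
  proof (induction k)
    case (Suc k)
    have "derived ?K ((derived ?K ^^ k) K) \<subseteq> derived ?K (?M k)"
      using Suc by (rule H.mono_derived)
    also have "\<dots> = derived G (?M k)"
      using MK K.subgroup_axioms by (rule derived_consistent)
    also have "\<dots> \<subseteq> ?M (Suc k)"
      using commutator_step_incl by simp
    finally show ?case by simp
  qed simp
  show ?thesis
  proof (rule H.residually_solvable_Mod)
    show "(\<Inter>k. ?M k) \<lhd> ?K"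
      using MK by (intro norm Inter_commutator_steps_normal[OF L K]) blast
    show "\<exists>M n. M \<lhd> ?K \<and> (\<Inter>k. ?M k) \<subseteq> M \<and> g \<notin> M \<and> (derived ?K ^^ n) (carrier ?K) \<subseteq> M"
      if g: "g \<notin> (\<Inter>k. ?M k)" for g
    proof -
      obtain k where "g \<notin> ?M k" using g by blast
      then show ?thesis
        using derived[of k] norm[OF commutator_steps_normal[OF L K] MK]
        by (intro exI[of _ "?M k"] exI[of _ k]) auto
    qed
  qed
qed

lemma residually_solvable_abelian:
  assumes L: "L \<lhd> G" and R: "R \<lhd> G" and LR: "L \<subseteq> R"
    and comm: "\<And>x y. x \<in> R \<Longrightarrow> y \<in> R \<Longrightarrow> x \<otimes> y \<otimes> inv x \<otimes> inv y \<in> L"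
  shows "residually_solvable (G\<lparr>carrier := R\<rparr> Mod L)"
proof -
  interpret R: normal R G by fact
  let ?R = "G\<lparr>carrier := R\<rparr>"
  interpret H: group ?R by (rule R.subgroup_is_group[OF is_group])
  have norm: "L \<lhd> ?R"
    using L LR R.subgroup_axioms normal_restrict_supergroup by blast
  have "derived G R \<subseteq> L"
    unfolding derived_def
    by (rule generate_subgroup_incl[OF _ normal_imp_subgroup[OF L]]) (use comm in auto)
  then have "(derived ?R ^^ 1) (carrier ?R) \<subseteq> L"
    using derived_consistent[OF order_refl R.subgroup_axioms] by simp
  with norm show ?thesis
    by (intro H.residually_solvable_Mod) blast+
qed

lemma poly_residually_solvable_interleave:
  assumes L: "\<And>i. L i \<lhd> G" and R: "\<And>i. R i \<lhd> G"
    and incl: "\<And>i. L i \<subseteq> R i" "\<And>i. R i \<subseteq> L (Suc i)"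
    and res: "\<And>i. residually_solvable (G\<lparr>carrier := R i\<rparr> Mod L i)"
      "\<And>i. residually_solvable (G\<lparr>carrier := L (Suc i)\<rparr> Mod R i)"
    and ends: "L 0 = {\<one>}" "L n = carrier G"
  shows "poly_residually_solvable G"
proof -
  \<comment> \<open>\<open>L\<close> stands at even and \<open>R\<close> at odd places, so the
    series has length \<open>2 * n\<close>.\<close>
  define N where "N i = (if even i then L (i div 2) else R (i div 2))" for i
  have "N 0 = {\<one>}" "N (2 * n) = carrier G" "N i \<lhd> G" for i
    by (simp_all add: N_def ends L R)
  moreover have "N i \<subseteq> N (Suc i) \<and> residually_solvable (G\<lparr>carrier := N (Suc i)\<rparr> Mod N i)" for i
    by (cases "even i") (simp_all add: N_def incl res)
  ultimately show ?thesis
    unfolding poly_residually_solvable_def by blast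
qed

end

text \<open>Two reductions to generators: the elements whose images commute with a fixed
  \<open>h s\<close> are closed under multiplication by \<open>T\<close>, and the elements central
  modulo the kernel form a normal subgroup, which contains the normal closure of \<open>S\<close>
  once it contains \<open>S\<close>.\<close>

lemma (in group_hom) commutators_of_normal_closure_in_kernel:
  assumes S: "S \<subseteq> carrier G"
    and T: "T \<subseteq> carrier G" "\<And>t. t \<in> T \<Longrightarrow> inv t \<in> T" "generate G T = carrier G"
    and comm: "\<And>s t. s \<in> S \<Longrightarrow> t \<in> T \<Longrightarrow> h s \<otimes>\<^bsub>H\<^esub> h t = h t \<otimes>\<^bsub>H\<^esub> h s"
    and x: "x \<in> normal_closure G S" and y: "y \<in> carrier G"
  shows "y \<otimes> x \<otimes> inv y \<otimes> inv x \<in> kernel G H h"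
proof -
  interpret K: normal "kernel G H h" G by (rule normal_kernel)
  let ?Z = "{x \<in> carrier G. \<forall>y\<in>carrier G. y \<otimes> x \<otimes> inv y \<otimes> inv x \<in> kernel G H h}"
  have "S \<subseteq> ?Z"
  proof
    fix s assume s: "s \<in> S"
    have "generate G T \<subseteq> {y \<in> carrier G. h s \<otimes>\<^bsub>H\<^esub> h y = h y \<otimes>\<^bsub>H\<^esub> h s}" (is "_ \<subseteq> ?C")
    proof (rule G.generate_induct_mult_left[OF T(1,2)])
      show "\<one> \<in> ?C" using s S by auto
      show "t \<otimes> y \<in> ?C" if t: "t \<in> T" and y: "y \<in> ?C" for t y
      proof -
        have carr: "s \<in> carrier G" "t \<in> carrier G" "y \<in> carrier G" using s t y S T(1) by auto
        have "h s \<otimes>\<^bsub>H\<^esub> (h t \<otimes>\<^bsub>H\<^esub> h y) = h t \<otimes>\<^bsub>H\<^esub> (h s \<otimes>\<^bsub>H\<^esub> h y)"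
          using carr comm[OF s t] by (simp flip: H.m_assoc)
        also have "\<dots> = h t \<otimes>\<^bsub>H\<^esub> h y \<otimes>\<^bsub>H\<^esub> h s"
          using carr y by (simp add: H.m_assoc)
        finally show ?thesis using carr by simp
      qed
    qed auto
    have "y \<otimes> s \<otimes> inv y \<otimes> inv s \<in> kernel G H h" if "y \<in> carrier G" for y
    proof -
      have carr: "s \<in> carrier G" "y \<in> carrier G" using s S that by auto
      have "h y \<otimes>\<^bsub>H\<^esub> h s = h s \<otimes>\<^bsub>H\<^esub> h y"
        using that \<open>generate G T \<subseteq> ?C\<close> T(3) by auto
      then have "h (y \<otimes> s \<otimes> inv y \<otimes> inv s) = h s \<otimes>\<^bsub>H\<^esub> h y \<otimes>\<^bsub>H\<^esub> inv\<^bsub>H\<^esub> h y \<otimes>\<^bsub>H\<^esub> inv\<^bsub>H\<^esub> h s"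
        using carr by simp
      also have "\<dots> = \<one>\<^bsub>H\<^esub>" using carr by (simp add: H.m_assoc)
      finally show ?thesis unfolding kernel_def using carr by blast
    qed
    then show "s \<in> ?Z" using s S by blast
  qed
  from G.normal_closure_minimal[OF K.center_preimage_normal this]
  show ?thesis using x y by blast
qed

section \<open>Separating homomorphisms of the amalgamated product\<close>

context amalgam
begin

abbreviation "letters \<equiv> \<alpha> ` carrier A \<union> \<beta> ` carrier B"

lemma letters_carrier: "letters \<subseteq> carrier G"
  using \<alpha>.hom_closed \<beta>.hom_closed by auto

lemma letters_inv: "t \<in> letters \<Longrightarrow> inv\<^bsub>G\<^esub> t \<in> letters"
  by (auto simp flip: \<alpha>.hom_inv \<beta>.hom_inv)

text \<open>The crossing numbers come from permutations of pairs of a group element and an integer: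
  both factors translate the first coordinate, and \<open>\<beta> b\<close> also adds the change of
  \<open>f\<close> to the second. Invariance of \<open>f\<close> makes the actions agree on
  \<open>C\<close>, so they extend to \<open>G\<close>; \<open>c g x\<close> is the integer reached
  from \<open>(x, 0)\<close>.\<close>

lemma amalgam_crossing_images: "amalgam_crossing G (\<alpha> ` carrier A) (\<beta> ` carrier B) (\<alpha> ` C)"
proof (intro amalgam_crossing.intro amalgam_crossing_axioms.intro)
  show "group G" by (rule G.group_axioms)
  show "subgroup (\<alpha> ` carrier A) G" by (rule \<alpha>.img_is_subgroup)
  show "subgroup (\<beta> ` carrier B) G" by (rule \<beta>.img_is_subgroup)
  show "subgroup (\<alpha> ` C) G" by (rule \<alpha>.subgroup_img_is_subgroup[OF C])
  show "\<alpha> ` C \<subseteq> \<alpha> ` carrier A" using C.subset by blast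
  show "\<alpha> ` C \<subseteq> \<beta> ` carrier B" using \<alpha>_eq_\<beta> \<phi>_closed by auto
  show "generate G letters = carrier G" by (rule generate_\<alpha>_\<beta>)
  fix f :: "('a + 'b) list set set \<Rightarrow> int"
  assume f: "\<And>d x. d \<in> \<alpha> ` C \<Longrightarrow> x \<in> carrier G \<Longrightarrow> f (d \<otimes>\<^bsub>G\<^esub> x) = f x"
  define h where "h a z = (if fst z \<in> carrier G then (\<alpha> a \<otimes>\<^bsub>G\<^esub> fst z, snd z) else z)"
    for a and z :: "('a + 'b) list set set \<times> int"
  define k where "k b z = (if fst z \<in> carrier G
      then (\<beta> b \<otimes>\<^bsub>G\<^esub> fst z, snd z + (f (\<beta> b \<otimes>\<^bsub>G\<^esub> fst z) - f (fst z))) else z)"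
    for b and z :: "('a + 'b) list set set \<times> int"
  have "h \<in> hom A (BijGroup UNIV)"
    by (rule hom_BijGroup_UNIV) (auto simp: h_def fun_eq_iff G.m_assoc A.group_axioms)
  moreover have "k \<in> hom B (BijGroup UNIV)"
    by (rule hom_BijGroup_UNIV) (auto simp: k_def fun_eq_iff G.m_assoc B.group_axioms)
  moreover have "h c = k (\<phi> c)" if "c \<in> C" for c
    using that f[of "\<alpha> c"] by (auto simp: h_def k_def fun_eq_iff \<alpha>_eq_\<beta>)
  ultimately obtain F where F: "F \<in> hom G (BijGroup UNIV)"
    "\<And>a. a \<in> carrier A \<Longrightarrow> F (\<alpha> a) = h a" "\<And>b. b \<in> carrier B \<Longrightarrow> F (\<beta> b) = k b"
    using universal[OF group_BijGroup] by metis
  interpret S: group "BijGroup (UNIV :: (('a + 'b) list set set \<times> int) set)"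
    by (rule group_BijGroup)
  interpret F: group_hom G "BijGroup UNIV" F
    by unfold_locales (rule F(1))
  have F_mult: "F (x \<otimes>\<^bsub>G\<^esub> y) z = F x (F y z)" if "x \<in> carrier G" "y \<in> carrier G" for x y z
    using F.hom_closed[OF that(1)] F.hom_closed[OF that(2)] F.hom_mult[OF that] by simp
  define c where "c g x = snd (F g (x, 0))" for g x
  have \<alpha>: "c (\<alpha> a) x = 0" if "a \<in> carrier A" "x \<in> carrier G" for a x
    using that by (simp add: c_def F h_def)
  have \<beta>: "c (\<beta> b) x = f (\<beta> b \<otimes>\<^bsub>G\<^esub> x) - f x" if "b \<in> carrier B" "x \<in> carrier G" for b x
    using that by (simp add: c_def F k_def)
  have letter: "F t (x, n) = (t \<otimes>\<^bsub>G\<^esub> x, n + c t x)" if "t \<in> letters" "x \<in> carrier G" for t x n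
    using that by (auto simp: \<alpha> \<beta>) (simp_all add: F h_def k_def)
  \<comment> \<open>The displacement of the integer does not depend on its starting value; this
    yields the product rule for \<open>c\<close>.\<close>
  have "generate G letters
      \<subseteq> {g \<in> carrier G. \<forall>x\<in>carrier G. \<forall>n. F g (x, n) = (g \<otimes>\<^bsub>G\<^esub> x, n + c g x)}" (is "_ \<subseteq> ?X")
  proof (rule G.generate_induct_mult_left[OF letters_carrier letters_inv])
    show "\<one>\<^bsub>G\<^esub> \<in> ?X"
      using F.hom_one by (simp add: c_def)
    show "t \<otimes>\<^bsub>G\<^esub> y \<in> ?X" if t: "t \<in> letters" and y: "y \<in> ?X" for t y
    proof -
      have carr: "t \<in> carrier G" "y \<in> carrier G" using t y letters_carrier by auto
      have *: "F (t \<otimes>\<^bsub>G\<^esub> y) (x, n) = (t \<otimes>\<^bsub>G\<^esub> y \<otimes>\<^bsub>G\<^esub> x, n + c y x + c t (y \<otimes>\<^bsub>G\<^esub> x))"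
        if "x \<in> carrier G" for x n
        using that y carr by (simp add: F_mult letter[OF t] G.m_assoc del: F.hom_mult)
      then have "c (t \<otimes>\<^bsub>G\<^esub> y) x = c y x + c t (y \<otimes>\<^bsub>G\<^esub> x)" if "x \<in> carrier G" for x
        using that by (simp add: c_def)
      with * carr show ?thesis by simp
    qed
  qed auto
  then have F_eq: "F g (x, n) = (g \<otimes>\<^bsub>G\<^esub> x, n + c g x)" if "g \<in> carrier G" "x \<in> carrier G" for g x n
    using that generate_\<alpha>_\<beta> by auto
  have "c (g \<otimes>\<^bsub>G\<^esub> h) x = c g (h \<otimes>\<^bsub>G\<^esub> x) + c h x"
    if "g \<in> carrier G" "h \<in> carrier G" "x \<in> carrier G" for g h x
    using F_mult[OF that(1,2), of "(x, 0)"] that by (simp add: F_eq del: F.hom_mult)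
  then show "\<exists>c. (\<forall>g\<in>carrier G. \<forall>h\<in>carrier G. \<forall>x\<in>carrier G. c (g \<otimes>\<^bsub>G\<^esub> h) x = c g (h \<otimes>\<^bsub>G\<^esub> x) + c h x) \<and>
      (\<forall>p\<in>\<alpha> ` carrier A. \<forall>x\<in>carrier G. c p x = 0) \<and>
      (\<forall>q\<in>\<beta> ` carrier B. \<forall>x\<in>carrier G. c q x = f (q \<otimes>\<^bsub>G\<^esub> x) - f x)"
    using \<alpha> \<beta> by (intro exI[of _ c]) auto
qed

text \<open>\<open>N\<close> is the kernel of the homomorphism on \<open>G\<close> induced by
  \<open>h\<close> and \<open>k\<close>. The images of \<open>X\<close> and \<open>Y\<close> commute
  with all letters in the representation, so their normal closure is central modulo
  \<open>N\<close>.\<close>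

lemma representation_kernel:
  assumes h: "h \<in> hom A (BijGroup UNIV)" and k: "k \<in> hom B (BijGroup UNIV)"
    and hk: "\<And>c. c \<in> C \<Longrightarrow> h c = k (\<phi> c)"
    and X: "X \<subseteq> carrier A" and Y: "Y \<subseteq> carrier B"
    and commX: "\<And>s a. s \<in> X \<Longrightarrow> a \<in> carrier A \<Longrightarrow> h s \<circ> h a = h a \<circ> h s"
      "\<And>s b. s \<in> X \<Longrightarrow> b \<in> carrier B \<Longrightarrow> h s \<circ> k b = k b \<circ> h s"
    and commY: "\<And>s a. s \<in> Y \<Longrightarrow> a \<in> carrier A \<Longrightarrow> k s \<circ> h a = h a \<circ> k s"
      "\<And>s b. s \<in> Y \<Longrightarrow> b \<in> carrier B \<Longrightarrow> k s \<circ> k b = k b \<circ> k s"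
  obtains N where "N \<lhd> G"
    "\<And>a. a \<in> carrier A \<Longrightarrow> \<alpha> a \<in> N \<longleftrightarrow> h a = id"
    "\<And>b. b \<in> carrier B \<Longrightarrow> \<beta> b \<in> N \<longleftrightarrow> k b = id"
    "\<And>x y. x \<in> normal_closure G (\<alpha> ` X \<union> \<beta> ` Y) \<Longrightarrow> y \<in> carrier G \<Longrightarrow>
      y \<otimes>\<^bsub>G\<^esub> x \<otimes>\<^bsub>G\<^esub> inv\<^bsub>G\<^esub> y \<otimes>\<^bsub>G\<^esub> inv\<^bsub>G\<^esub> x \<in> N"
proof -
  obtain f where f: "f \<in> hom G (BijGroup UNIV)"
    "\<And>a. a \<in> carrier A \<Longrightarrow> f (\<alpha> a) = h a" "\<And>b. b \<in> carrier B \<Longrightarrow> f (\<beta> b) = k b"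
    using universal[OF group_BijGroup h k hk] by metis
  interpret f: group_hom G "BijGroup UNIV" f
    using f(1) group_BijGroup G.group_axioms by (simp add: group_hom_def group_hom_axioms_def)
  show thesis
  proof (rule that[of "kernel G (BijGroup UNIV) f"])
    show "kernel G (BijGroup UNIV) f \<lhd> G" by (rule f.normal_kernel)
    show "\<alpha> a \<in> kernel G (BijGroup UNIV) f \<longleftrightarrow> h a = id" if "a \<in> carrier A" for a
      using that f(2) by (simp add: kernel_def)
    show "\<beta> b \<in> kernel G (BijGroup UNIV) f \<longleftrightarrow> k b = id" if "b \<in> carrier B" for b
      using that f(3) by (simp add: kernel_def)
    fix x y assume xy: "x \<in> normal_closure G (\<alpha> ` X \<union> \<beta> ` Y)" "y \<in> carrier G"
    have XY: "\<alpha> ` X \<union> \<beta> ` Y \<subseteq> letters" using X Y by blast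
    have bij: "bij (f t)" if "t \<in> letters" for t
      using f.hom_closed[of t] letters_carrier that by auto
    have comm: "f s \<circ> f t = f t \<circ> f s" if s: "s \<in> \<alpha> ` X \<union> \<beta> ` Y" and t: "t \<in> letters" for s t
    proof -
      have "f (\<alpha> a) = h a" if "a \<in> X" for a using that X f(2) by blast
      moreover have "f (\<beta> b) = k b" if "b \<in> Y" for b using that Y f(3) by blast
      ultimately show ?thesis
        using s t by (elim UnE imageE) (simp_all add: f(2,3) commX commY)
    qed
    have comm': "f s \<otimes>\<^bsub>BijGroup UNIV\<^esub> f t = f t \<otimes>\<^bsub>BijGroup UNIV\<^esub> f s"
      if "s \<in> \<alpha> ` X \<union> \<beta> ` Y" "t \<in> letters" for s t
    proof -
      have "bij (f s)" "bij (f t)" using that XY bij by blast+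
      then show ?thesis using comm[OF that] by simp
    qed
    show "y \<otimes>\<^bsub>G\<^esub> x \<otimes>\<^bsub>G\<^esub> inv\<^bsub>G\<^esub> y \<otimes>\<^bsub>G\<^esub> inv\<^bsub>G\<^esub> x \<in> kernel G (BijGroup UNIV) f"
      by (rule f.commutators_of_normal_closure_in_kernel[OF _ letters_carrier letters_inv
          generate_\<alpha>_\<beta> comm' xy]) (use XY letters_carrier in blast)+
  qed
qed

text \<open>Lets \<open>C\<close> serve as the group \<open>D\<close> of
  \<open>amalgam_separating_representation\<close>, with this inclusion as one of its two maps and
  \<open>\<phi>\<close> as the other.\<close>

lemma inclusion_group_hom: "group_hom (A\<lparr>carrier := C\<rparr>) A (\<lambda>x. x)"
  using A.group_axioms C.subgroup_is_group[OF A.group_axioms] C.subset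
  by (auto simp: group_hom_def group_hom_axioms_def hom_def)

text \<open>The kernel of the separating representation is large enough to make the images of
  \<open>Z\<close> and \<open>W\<close> central modulo \<open>N\<close>, and small enough to meet
  the image of \<open>A\<close> only in that of \<open>U (C \<inter> Z)\<close>.\<close>

lemma separating_kernel_left:
  assumes "U \<lhd> A" "Z \<lhd> A" "U \<subseteq> Z" "W \<lhd> B"
    and comm: "\<And>x z. x \<in> carrier A \<Longrightarrow> z \<in> Z \<Longrightarrow>
      x \<otimes>\<^bsub>A\<^esub> z \<otimes>\<^bsub>A\<^esub> inv\<^bsub>A\<^esub> x \<otimes>\<^bsub>A\<^esub> inv\<^bsub>A\<^esub> z \<in> U"
    and same: "\<And>c. c \<in> C \<Longrightarrow> c \<in> Z \<longleftrightarrow> \<phi> c \<in> W"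
  obtains N where "N \<lhd> G" "\<alpha> ` U \<subseteq> N" "\<beta> ` W \<subseteq> N"
    "\<And>a. a \<in> carrier A \<Longrightarrow> \<alpha> a \<in> N \<Longrightarrow> a \<in> U <#>\<^bsub>A\<^esub> (C \<inter> Z)"
    "\<And>x y. x \<in> normal_closure G (\<alpha> ` Z \<union> \<beta> ` W) \<Longrightarrow> y \<in> carrier G \<Longrightarrow>
      y \<otimes>\<^bsub>G\<^esub> x \<otimes>\<^bsub>G\<^esub> inv\<^bsub>G\<^esub> y \<otimes>\<^bsub>G\<^esub> inv\<^bsub>G\<^esub> x \<in> N"
proof -
  have same': "c \<in> carrier (A\<lparr>carrier := C\<rparr>) \<Longrightarrow> c \<in> Z \<longleftrightarrow> \<phi> c \<in> W" for c
    using same by simp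
  interpret U: normal U A by fact
  interpret Z: normal Z A by fact
  interpret W: normal W B by fact
  obtain h :: "'a \<Rightarrow> 'a set \<times> 'b set \<times> 'a set \<Rightarrow> 'a set \<times> 'b set \<times> 'a set" and k where hk:
    "h \<in> hom A (BijGroup UNIV)" "k \<in> hom B (BijGroup UNIV)"
    "\<And>d. d \<in> carrier (A\<lparr>carrier := C\<rparr>) \<Longrightarrow> h d = k (\<phi> d)"
    "\<And>a. a \<in> carrier A \<Longrightarrow> h a = id \<Longrightarrow>
      a \<in> U <#>\<^bsub>A\<^esub> ((\<lambda>x. x) ` carrier (A\<lparr>carrier := C\<rparr>) \<inter> Z)"
    "\<And>u. u \<in> U \<Longrightarrow> h u = id" "\<And>w. w \<in> W \<Longrightarrow> k w = id"
    "\<And>z a. z \<in> Z \<Longrightarrow> a \<in> carrier A \<Longrightarrow> h z \<circ> h a = h a \<circ> h z"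
    "\<And>z b. z \<in> Z \<Longrightarrow> b \<in> carrier B \<Longrightarrow> h z \<circ> k b = k b \<circ> h z"
    by (rule amalgam_separating_representation[OF inclusion_group_hom \<phi>.group_hom_axioms
        assms(1-4) comm same']) (assumption+, rule that)
  have hk3: "h c = k (\<phi> c)" if "c \<in> C" for c using hk(3) that by simp
  obtain N where N: "N \<lhd> G"
    "\<And>a. a \<in> carrier A \<Longrightarrow> \<alpha> a \<in> N \<longleftrightarrow> h a = id"
    "\<And>b. b \<in> carrier B \<Longrightarrow> \<beta> b \<in> N \<longleftrightarrow> k b = id"
    "\<And>x y. x \<in> normal_closure G (\<alpha> ` Z \<union> \<beta> ` W) \<Longrightarrow> y \<in> carrier G \<Longrightarrow>
      y \<otimes>\<^bsub>G\<^esub> x \<otimes>\<^bsub>G\<^esub> inv\<^bsub>G\<^esub> y \<otimes>\<^bsub>G\<^esub> inv\<^bsub>G\<^esub> x \<in> N"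
    \<comment> \<open>Elements of \<open>W\<close> act trivially, so their commutation conditions
      hold at once.\<close>
    by (rule representation_kernel[OF hk(1,2) hk3 Z.subset W.subset hk(7,8)])
      (assumption | rule that | simp add: hk(6))+
  show thesis
    by (rule that[OF N(1) _ _ _ N(4)]) (use N(2,3) hk(4-6) in auto)
qed

text \<open>The separating representation takes two maps out of a common group, so
  \<open>\<phi>\<close> and the inclusion of \<open>C\<close> simply change places.\<close>

lemma separating_kernel_right:
  assumes "U \<lhd> B" "Z \<lhd> B" "U \<subseteq> Z" "W \<lhd> A"
    and comm: "\<And>x z. x \<in> carrier B \<Longrightarrow> z \<in> Z \<Longrightarrow>
      x \<otimes>\<^bsub>B\<^esub> z \<otimes>\<^bsub>B\<^esub> inv\<^bsub>B\<^esub> x \<otimes>\<^bsub>B\<^esub> inv\<^bsub>B\<^esub> z \<in> U"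
    and same: "\<And>c. c \<in> C \<Longrightarrow> \<phi> c \<in> Z \<longleftrightarrow> c \<in> W"
  obtains N where "N \<lhd> G" "\<alpha> ` W \<subseteq> N" "\<beta> ` U \<subseteq> N"
    "\<And>b. b \<in> carrier B \<Longrightarrow> \<beta> b \<in> N \<Longrightarrow> b \<in> U <#>\<^bsub>B\<^esub> (\<phi> ` C \<inter> Z)"
    "\<And>x y. x \<in> normal_closure G (\<alpha> ` W \<union> \<beta> ` Z) \<Longrightarrow> y \<in> carrier G \<Longrightarrow>
      y \<otimes>\<^bsub>G\<^esub> x \<otimes>\<^bsub>G\<^esub> inv\<^bsub>G\<^esub> y \<otimes>\<^bsub>G\<^esub> inv\<^bsub>G\<^esub> x \<in> N"
proof -
  have same': "c \<in> carrier (A\<lparr>carrier := C\<rparr>) \<Longrightarrow> \<phi> c \<in> Z \<longleftrightarrow> c \<in> W" for c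
    using same by simp
  interpret U: normal U B by fact
  interpret Z: normal Z B by fact
  interpret W: normal W A by fact
  obtain h :: "'b \<Rightarrow> 'b set \<times> 'a set \<times> 'b set \<Rightarrow> 'b set \<times> 'a set \<times> 'b set" and k where hk:
    "h \<in> hom B (BijGroup UNIV)" "k \<in> hom A (BijGroup UNIV)"
    "\<And>d. d \<in> carrier (A\<lparr>carrier := C\<rparr>) \<Longrightarrow> h (\<phi> d) = k d"
    "\<And>a. a \<in> carrier B \<Longrightarrow> h a = id \<Longrightarrow>
      a \<in> U <#>\<^bsub>B\<^esub> (\<phi> ` carrier (A\<lparr>carrier := C\<rparr>) \<inter> Z)"
    "\<And>u. u \<in> U \<Longrightarrow> h u = id" "\<And>w. w \<in> W \<Longrightarrow> k w = id"
    "\<And>z a. z \<in> Z \<Longrightarrow> a \<in> carrier B \<Longrightarrow> h z \<circ> h a = h a \<circ> h z"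
    "\<And>z b. z \<in> Z \<Longrightarrow> b \<in> carrier A \<Longrightarrow> h z \<circ> k b = k b \<circ> h z"
    by (rule amalgam_separating_representation[OF \<phi>.group_hom_axioms inclusion_group_hom
        assms(1-4) comm same']) (assumption+, rule that)
  have hk3: "k c = h (\<phi> c)" if "c \<in> C" for c using hk(3) that by simp
  obtain N where N: "N \<lhd> G"
    "\<And>a. a \<in> carrier A \<Longrightarrow> \<alpha> a \<in> N \<longleftrightarrow> k a = id"
    "\<And>b. b \<in> carrier B \<Longrightarrow> \<beta> b \<in> N \<longleftrightarrow> h b = id"
    "\<And>x y. x \<in> normal_closure G (\<alpha> ` W \<union> \<beta> ` Z) \<Longrightarrow> y \<in> carrier G \<Longrightarrow>
      y \<otimes>\<^bsub>G\<^esub> x \<otimes>\<^bsub>G\<^esub> inv\<^bsub>G\<^esub> y \<otimes>\<^bsub>G\<^esub> inv\<^bsub>G\<^esub> x \<in> N"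
    by (rule representation_kernel[OF hk(2,1) hk3 W.subset Z.subset _ _ hk(8,7)])
      (assumption | rule that | simp add: hk(6))+
  show thesis
    by (rule that[OF N(1) _ _ _ N(4)]) (use N(2,3) hk(4-6) in auto)
qed

end

section \<open>The normal series\<close>

context amalgam
begin

section \<open>One step of the series: from the closure of \<open>U\<^sub>A\<close>,
  \<open>U\<^sub>B\<close> to that of \<open>Z\<^sub>A\<close>, \<open>Z\<^sub>B\<close>\<close>

context
  fixes U\<^sub>A Z\<^sub>A U\<^sub>B Z\<^sub>B L K R
  assumes L_def: "L = normal_closure G (\<alpha> ` U\<^sub>A \<union> \<beta> ` U\<^sub>B)"
    and K_def: "K = normal_closure G (\<alpha> ` Z\<^sub>A \<union> \<beta> ` Z\<^sub>B)"
    and R_def: "R = (\<Inter>k. (G.commutator_step L ^^ k) K)"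
    and norm: "U\<^sub>A \<lhd> A" "Z\<^sub>A \<lhd> A" "U\<^sub>B \<lhd> B" "Z\<^sub>B \<lhd> B"
    and incl: "U\<^sub>A \<subseteq> Z\<^sub>A" "U\<^sub>B \<subseteq> Z\<^sub>B"
    and comm\<^sub>A: "\<And>x z. x \<in> carrier A \<Longrightarrow> z \<in> Z\<^sub>A \<Longrightarrow>
      x \<otimes>\<^bsub>A\<^esub> z \<otimes>\<^bsub>A\<^esub> inv\<^bsub>A\<^esub> x \<otimes>\<^bsub>A\<^esub> inv\<^bsub>A\<^esub> z \<in> U\<^sub>A"
    and comm\<^sub>B: "\<And>x z. x \<in> carrier B \<Longrightarrow> z \<in> Z\<^sub>B \<Longrightarrow>
      x \<otimes>\<^bsub>B\<^esub> z \<otimes>\<^bsub>B\<^esub> inv\<^bsub>B\<^esub> x \<otimes>\<^bsub>B\<^esub> inv\<^bsub>B\<^esub> z \<in> U\<^sub>B"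
    and compat: "\<And>c. c \<in> C \<Longrightarrow> c \<in> Z\<^sub>A \<longleftrightarrow> \<phi> c \<in> Z\<^sub>B"
begin

interpretation U\<^sub>A: normal U\<^sub>A A by (rule norm)
interpretation Z\<^sub>A: normal Z\<^sub>A A by (rule norm)
interpretation U\<^sub>B: normal U\<^sub>B B by (rule norm)
interpretation Z\<^sub>B: normal Z\<^sub>B B by (rule norm)

interpretation L: normal L G
  unfolding L_def by (rule G.normal_closure_normal) (use letters_carrier U\<^sub>A.subset U\<^sub>B.subset in blast)

interpretation K: normal K G
  unfolding K_def by (rule G.normal_closure_normal) (use letters_carrier Z\<^sub>A.subset Z\<^sub>B.subset in blast)

interpretation amalgam_crossing G "\<alpha> ` carrier A" "\<beta> ` carrier B" "\<alpha> ` C"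
  by (rule amalgam_crossing_images)

lemma images_subset_L: "\<alpha> ` U\<^sub>A \<subseteq> L" "\<beta> ` U\<^sub>B \<subseteq> L"
  using G.normal_closure_incl[of "\<alpha> ` U\<^sub>A \<union> \<beta> ` U\<^sub>B"] by (auto simp: L_def)

lemma L_subset_K: "L \<subseteq> K"
  using incl G.normal_closure_incl[of "\<alpha> ` Z\<^sub>A \<union> \<beta> ` Z\<^sub>B"]
  unfolding L_def K_def[symmetric] by (intro G.normal_closure_minimal[OF K.normal_axioms]) blast

lemma L_gen: "L \<subseteq> normal_closure G (L \<inter> letters)"
proof (rule subset_trans[OF equalityD1[OF L_def]], rule G.normal_closure_minimal)
  show "normal_closure G (L \<inter> letters) \<lhd> G"
    by (rule G.normal_closure_normal) (use letters_carrier in blast)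
  show "\<alpha> ` U\<^sub>A \<union> \<beta> ` U\<^sub>B \<subseteq> normal_closure G (L \<inter> letters)"
    using images_subset_L image_mono[OF U\<^sub>A.subset, of \<alpha>] image_mono[OF U\<^sub>B.subset, of \<beta>]
    by (intro subset_trans[OF _ G.normal_closure_incl]) auto
qed

lemma commutator_step_subset_kernel:
  assumes "N \<lhd> G" "\<alpha> ` U\<^sub>A \<subseteq> N" "\<beta> ` U\<^sub>B \<subseteq> N"
    and "\<And>x y. x \<in> K \<Longrightarrow> y \<in> carrier G \<Longrightarrow>
      y \<otimes>\<^bsub>G\<^esub> x \<otimes>\<^bsub>G\<^esub> inv\<^bsub>G\<^esub> y \<otimes>\<^bsub>G\<^esub> inv\<^bsub>G\<^esub> x \<in> N"
  shows "G.commutator_step L K \<subseteq> N"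
proof (rule G.commutator_step_minimal[OF assms(1) K.subset])
  show "L \<subseteq> N" unfolding L_def using assms by (intro G.normal_closure_minimal) auto
qed (use assms(4) in auto)

text \<open>If a letter \<open>x\<close> equals \<open>m \<otimes> \<alpha> c\<close>, then
  \<open>m\<close> comes from the same factor as \<open>x\<close>. The separating kernel for that
  factor contains the first commutator step, so \<open>m\<close> lies in the image of
  \<open>U (C \<inter> Z)\<close>, and therefore \<open>x\<close> in \<open>L C\<close>.\<close>

lemma avoids_first_step: "avoids (L <#>\<^bsub>G\<^esub> \<alpha> ` C) 1 (G.commutator_step L K)"
  unfolding avoids_def
proof (intro allI impI notI)
  fix s xs
  assume xs: "reduced (L <#>\<^bsub>G\<^esub> \<alpha> ` C) s xs" "xs \<noteq> []" "length xs \<le> 1"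
    "word_prod xs \<in> G.commutator_step L K <#>\<^bsub>G\<^esub> \<alpha> ` C"
  then obtain x where x: "xs = [x]" by (cases xs) auto
  have xG: "x \<in> carrier G" using reduced_carrier[OF xs(1)] x by simp
  then obtain m c where mc: "x = m \<otimes>\<^bsub>G\<^esub> \<alpha> c" "m \<in> G.commutator_step L K" "c \<in> C"
    using xs(4) x by (auto simp: set_mult_def)
  have step: "G.commutator_step L K \<subseteq> carrier G"
    using G.commutator_step_normal[OF L.subset K.subset] normal_imp_subgroup subgroup.subset by blast
  then have m: "m = x \<otimes>\<^bsub>G\<^esub> inv\<^bsub>G\<^esub> \<alpha> c"
    using mc by (auto simp: G.m_assoc)
  have xH: "x \<notin> L <#>\<^bsub>G\<^esub> \<alpha> ` C" using xs(1) x by simp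
  show False
  proof (cases s)
    case True
    then obtain a where a: "a \<in> carrier A" "x = \<alpha> a" using xs(1) x by auto
    obtain N where N: "N \<lhd> G" "\<alpha> ` U\<^sub>A \<subseteq> N" "\<beta> ` Z\<^sub>B \<subseteq> N"
      "\<And>a. a \<in> carrier A \<Longrightarrow> \<alpha> a \<in> N \<Longrightarrow> a \<in> U\<^sub>A <#>\<^bsub>A\<^esub> (C \<inter> Z\<^sub>A)"
      "\<And>x y. x \<in> K \<Longrightarrow> y \<in> carrier G \<Longrightarrow>
        y \<otimes>\<^bsub>G\<^esub> x \<otimes>\<^bsub>G\<^esub> inv\<^bsub>G\<^esub> y \<otimes>\<^bsub>G\<^esub> inv\<^bsub>G\<^esub> x \<in> N"
      by (rule separating_kernel_left[OF norm(1,2) incl(1) norm(4) comm\<^sub>A compat, folded K_def])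
        (assumption | rule that)+
    have "G.commutator_step L K \<subseteq> N"
      by (rule commutator_step_subset_kernel[OF N(1,2) subset_trans[OF image_mono[OF incl(2)] N(3)] N(5)])
    then have "\<alpha> (a \<otimes>\<^bsub>A\<^esub> inv\<^bsub>A\<^esub> c) \<in> N"
      using mc a m by auto
    then obtain u d where ud: "a \<otimes>\<^bsub>A\<^esub> inv\<^bsub>A\<^esub> c = u \<otimes>\<^bsub>A\<^esub> d" "u \<in> U\<^sub>A" "d \<in> C"
      using N(4)[of "a \<otimes>\<^bsub>A\<^esub> inv\<^bsub>A\<^esub> c"] a mc by (auto simp: set_mult_def)
    then have "a = u \<otimes>\<^bsub>A\<^esub> (d \<otimes>\<^bsub>A\<^esub> c)"
      using a mc(3) A.inv_solve_right'[of "u \<otimes>\<^bsub>A\<^esub> d" a c] by (simp add: A.m_assoc)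
    then have "x = \<alpha> u \<otimes>\<^bsub>G\<^esub> \<alpha> (d \<otimes>\<^bsub>A\<^esub> c)"
      using a ud mc(3) by simp
    then have "x \<in> L <#>\<^bsub>G\<^esub> \<alpha> ` C"
      using images_subset_L ud mc(3) unfolding set_mult_def by blast
    then show False using xH by simp
  next
    case False
    then obtain b where b: "b \<in> carrier B" "x = \<beta> b" using xs(1) x by auto
    obtain N where N: "N \<lhd> G" "\<alpha> ` Z\<^sub>A \<subseteq> N" "\<beta> ` U\<^sub>B \<subseteq> N"
      "\<And>b. b \<in> carrier B \<Longrightarrow> \<beta> b \<in> N \<Longrightarrow> b \<in> U\<^sub>B <#>\<^bsub>B\<^esub> (\<phi> ` C \<inter> Z\<^sub>B)"
      "\<And>x y. x \<in> K \<Longrightarrow> y \<in> carrier G \<Longrightarrow>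
        y \<otimes>\<^bsub>G\<^esub> x \<otimes>\<^bsub>G\<^esub> inv\<^bsub>G\<^esub> y \<otimes>\<^bsub>G\<^esub> inv\<^bsub>G\<^esub> x \<in> N"
      by (rule separating_kernel_right[OF norm(3,4) incl(2) norm(2) comm\<^sub>B compat[symmetric], folded K_def])
        (assumption | rule that)+
    have "G.commutator_step L K \<subseteq> N"
      by (rule commutator_step_subset_kernel[OF N(1) subset_trans[OF image_mono[OF incl(1)] N(2)] N(3,5)])
    then have "\<beta> (b \<otimes>\<^bsub>B\<^esub> inv\<^bsub>B\<^esub> \<phi> c) \<in> N"
      using mc b m \<phi>_closed by (auto simp: \<alpha>_eq_\<beta>)
    then obtain u d where ud: "b \<otimes>\<^bsub>B\<^esub> inv\<^bsub>B\<^esub> \<phi> c = u \<otimes>\<^bsub>B\<^esub> \<phi> d" "u \<in> U\<^sub>B" "d \<in> C"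
      using N(4)[of "b \<otimes>\<^bsub>B\<^esub> inv\<^bsub>B\<^esub> \<phi> c"] b mc \<phi>_closed by (auto simp: set_mult_def)
    then have "b = u \<otimes>\<^bsub>B\<^esub> (\<phi> d \<otimes>\<^bsub>B\<^esub> \<phi> c)"
      using b mc(3) \<phi>_closed B.inv_solve_right'[of "u \<otimes>\<^bsub>B\<^esub> \<phi> d" b "\<phi> c"]
      by (simp add: B.m_assoc)
    then have "x = \<beta> u \<otimes>\<^bsub>G\<^esub> \<alpha> (d \<otimes>\<^bsub>A\<^esub> c)"
      using b ud mc(3) \<phi>_closed \<phi>.hom_mult[of d c] by (simp add: \<alpha>_eq_\<beta>)
    then have "x \<in> L <#>\<^bsub>G\<^esub> \<alpha> ` C"
      using images_subset_L ud mc(3) unfolding set_mult_def by blast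
    then show False using xH by simp
  qed
qed

text \<open>The separating kernel for \<open>U = Z = Z\<^sub>A\<close> contains \<open>K\<close>,
  and only elements of \<open>Z\<^sub>A\<close> are mapped into it by
  \<open>\<alpha>\<close>.\<close>

lemma C_Int_K:
  assumes "c \<in> C" "\<alpha> c \<in> K"
  shows "c \<in> Z\<^sub>A"
proof -
  have comm: "x \<otimes>\<^bsub>A\<^esub> z \<otimes>\<^bsub>A\<^esub> inv\<^bsub>A\<^esub> x \<otimes>\<^bsub>A\<^esub> inv\<^bsub>A\<^esub> z \<in> Z\<^sub>A" if "x \<in> carrier A" "z \<in> Z\<^sub>A" for x z
    using comm\<^sub>A[OF that] incl(1) by blast
  obtain N where N: "N \<lhd> G" "\<alpha> ` Z\<^sub>A \<subseteq> N" "\<beta> ` Z\<^sub>B \<subseteq> N"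
    "\<And>a. a \<in> carrier A \<Longrightarrow> \<alpha> a \<in> N \<Longrightarrow> a \<in> Z\<^sub>A <#>\<^bsub>A\<^esub> (C \<inter> Z\<^sub>A)"
    by (rule separating_kernel_left[OF norm(2,2) order_refl norm(4) comm compat])
      (assumption | rule that)+
  have "K \<subseteq> N" unfolding K_def using N by (intro G.normal_closure_minimal) auto
  then show ?thesis
    using N(4)[of c] assms by (auto simp: set_mult_def)
qed

lemma R_subset: "R \<subseteq> L <#>\<^bsub>G\<^esub> \<alpha> ` C"
  unfolding R_def by (rule Inter_commutator_steps_subset[OF L.normal_axioms L_gen HOL.refl K.normal_axioms
        L_subset_K avoids_first_step])

text \<open>Modulo \<open>L\<close>, an element of \<open>R\<close> is the image of some
  \<open>c\<close> in \<open>C\<close>; as \<open>R\<close> lies in \<open>K\<close>,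
  \<open>C_Int_K\<close> puts \<open>c\<close> into \<open>Z\<^sub>A\<close>. Commutators of such
  elements fall into \<open>U\<^sub>A\<close>.\<close>

lemma R_commutators:
  assumes x: "x \<in> R" and y: "y \<in> R"
  shows "x \<otimes>\<^bsub>G\<^esub> y \<otimes>\<^bsub>G\<^esub> inv\<^bsub>G\<^esub> x \<otimes>\<^bsub>G\<^esub> inv\<^bsub>G\<^esub> y \<in> L"
proof -
  interpret q: group_hom G "G Mod L" "\<lambda>x. L #>\<^bsub>G\<^esub> x" by (rule L.r_coset_group_hom)
  have rep: "\<exists>c \<in> C \<inter> Z\<^sub>A. z \<in> carrier G \<and> L #>\<^bsub>G\<^esub> z = L #>\<^bsub>G\<^esub> \<alpha> c" if z: "z \<in> R" for z
  proof -
    obtain l c where lc: "l \<in> L" "c \<in> C" "z = l \<otimes>\<^bsub>G\<^esub> \<alpha> c"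
      using z R_subset by (auto simp: set_mult_def)
    have "z \<in> (G.commutator_step L ^^ 0) K" using z unfolding R_def by blast
    then have "z \<in> K" by simp
    then have "\<alpha> c \<in> K"
      using lc L_subset_K G.subgroup_mult_left_iff[OF K.subgroup_axioms, of l "\<alpha> c"] by auto
    then have "c \<in> Z\<^sub>A" using C_Int_K lc by blast
    moreover have "L #>\<^bsub>G\<^esub> z = (L #>\<^bsub>G\<^esub> l) #>\<^bsub>G\<^esub> \<alpha> c"
      unfolding lc(3) using lc by (intro G.coset_mult_assoc[symmetric] L.subset) auto
    then have "L #>\<^bsub>G\<^esub> z = L #>\<^bsub>G\<^esub> \<alpha> c"
      using L.rcos_const[OF G.group_axioms lc(1)] by simp
    ultimately show ?thesis using lc by auto
  qed
  obtain c d where c: "c \<in> C" "c \<in> Z\<^sub>A" "x \<in> carrier G" "L #>\<^bsub>G\<^esub> x = L #>\<^bsub>G\<^esub> \<alpha> c"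
    and d: "d \<in> C" "d \<in> Z\<^sub>A" "y \<in> carrier G" "L #>\<^bsub>G\<^esub> y = L #>\<^bsub>G\<^esub> \<alpha> d"
    using rep[OF x] rep[OF y] by blast
  have "L #>\<^bsub>G\<^esub> (x \<otimes>\<^bsub>G\<^esub> y \<otimes>\<^bsub>G\<^esub> inv\<^bsub>G\<^esub> x \<otimes>\<^bsub>G\<^esub> inv\<^bsub>G\<^esub> y)
      = L #>\<^bsub>G\<^esub> \<alpha> (c \<otimes>\<^bsub>A\<^esub> d \<otimes>\<^bsub>A\<^esub> inv\<^bsub>A\<^esub> c \<otimes>\<^bsub>A\<^esub> inv\<^bsub>A\<^esub> d)"
    using c d by (simp del: mult_FactGroup)
  also have "\<dots> = L"
  proof -
    have "\<alpha> (c \<otimes>\<^bsub>A\<^esub> d \<otimes>\<^bsub>A\<^esub> inv\<^bsub>A\<^esub> c \<otimes>\<^bsub>A\<^esub> inv\<^bsub>A\<^esub> d) \<in> L"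
      using comm\<^sub>A[OF C.mem_carrier[OF c(1)] d(2)] by (intro subsetD[OF images_subset_L(1)] imageI)
    from iffD2[OF L.r_coset_eq_iff[OF L.mem_carrier[OF this]] this] show ?thesis .
  qed
  finally show ?thesis
    by (rule iffD1[OF L.r_coset_eq_iff, rotated]) (use c d in simp)
qed

lemma refinement_step:
  "R \<lhd> G" "L \<subseteq> R" "R \<subseteq> K"
  "residually_solvable (G\<lparr>carrier := R\<rparr> Mod L)"
  "residually_solvable (G\<lparr>carrier := K\<rparr> Mod R)"
proof -
  show R: "R \<lhd> G"
    unfolding R_def using L.normal_axioms K.normal_axioms by (rule G.Inter_commutator_steps_normal)
  show LR: "L \<subseteq> R"
    unfolding R_def using G.commutator_steps_incl[OF L_subset_K] by blast
  have "R \<subseteq> (G.commutator_step L ^^ 0) K" unfolding R_def by blast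
  then show "R \<subseteq> K" by simp
  show "residually_solvable (G\<lparr>carrier := R\<rparr> Mod L)"
    using L.normal_axioms R LR R_commutators by (rule G.residually_solvable_abelian)
  show "residually_solvable (G\<lparr>carrier := K\<rparr> Mod R)"
    unfolding R_def using L.normal_axioms K.normal_axioms L_subset_K
    by (rule G.residually_solvable_Inter_commutator_steps)
qed

end

end

theorem theorem8:
  fixes A :: "('a, 'c) monoid_scheme" and B :: "('b, 'd) monoid_scheme"
    and C\<^sub>A :: "'a set" and C\<^sub>B :: "'b set" and \<phi> :: "'a \<Rightarrow> 'b"
  assumes "group A" and "finitely_generated A" and "nilpotent A"
    and "group B" and "finitely_generated B" and "nilpotent B"
    and "subgroup C\<^sub>A A" and "subgroup C\<^sub>B B"
    and "\<phi> \<in> iso (A\<lparr>carrier := C\<^sub>A\<rparr>) (B\<lparr>carrier := C\<^sub>B\<rparr>)"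
    and "\<And>i. \<phi> \<in> iso (A\<lparr>carrier := upper_central A i \<inter> C\<^sub>A\<rparr>)
                    (B\<lparr>carrier := upper_central B i \<inter> C\<^sub>B\<rparr>)"
  shows "poly_residually_solvable (amalgamated_product A B C\<^sub>A \<phi>)"
proof -
  have bij: "bij_betw \<phi> C\<^sub>A C\<^sub>B" and bij_i: "bij_betw \<phi> (upper_central A i \<inter> C\<^sub>A) (upper_central B i \<inter> C\<^sub>B)" for i
    using assms(9) assms(10)[of i] by (simp_all add: iso_def)
  have "\<phi> \<in> hom (A\<lparr>carrier := C\<^sub>A\<rparr>) B"
    using assms(9) subgroup.subset[OF assms(8)] by (auto simp: iso_def hom_def)
  then interpret amalgam A B C\<^sub>A \<phi>
    using assms by (simp add: amalgam_def amalgam_axioms_def)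
  have compat: "c \<in> upper_central A i \<longleftrightarrow> \<phi> c \<in> upper_central B i" if c: "c \<in> C\<^sub>A" for c i
  proof
    show "\<phi> c \<in> upper_central B i" if "c \<in> upper_central A i"
      using bij_betw_apply[OF bij_i] c that by blast
    \<comment> \<open>Surjectivity at level \<open>i\<close> yields a preimage in
      \<open>upper_central A i\<close>; injectivity on all of \<open>C\<^sub>A\<close> shows that it
      is \<open>c\<close>.\<close>
    assume "\<phi> c \<in> upper_central B i"
    then have "\<phi> c \<in> \<phi> ` (upper_central A i \<inter> C\<^sub>A)"
      using bij_betw_imp_surj_on[OF bij_i[of i]] bij_betw_apply[OF bij c] by blast
    then show "c \<in> upper_central A i"
      using bij_betw_imp_inj_on[OF bij] c by (auto dest: inj_onD)
  qed
  define L where "L i = normal_closure G (\<alpha> ` upper_central A i \<union> \<beta> ` upper_central B i)" for i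
  define R where "R i = (\<Inter>k. (G.commutator_step (L i) ^^ k) (L (Suc i)))" for i
  note step = refinement_step[OF L_def L_def R_def A.upper_central_normal A.upper_central_normal
      B.upper_central_normal B.upper_central_normal A.upper_central_Suc B.upper_central_Suc
      A.upper_central_commutator B.upper_central_commutator compat]
  have carr: "\<alpha> ` upper_central A i \<union> \<beta> ` upper_central B i \<subseteq> letters" for i
    using subgroup.subset[OF normal_imp_subgroup[OF A.upper_central_normal]]
      subgroup.subset[OF normal_imp_subgroup[OF B.upper_central_normal]] by blast
  have L: "L i \<lhd> G" for i
    unfolding L_def using carr letters_carrier by (intro G.normal_closure_normal) blast
  have "L 0 \<subseteq> {\<one>\<^bsub>G\<^esub>}"
    unfolding L_def by (rule G.normal_closure_minimal[OF G.one_is_normal]) auto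
  then have L0: "L 0 = {\<one>\<^bsub>G\<^esub>}"
    using subgroup.one_closed[OF normal_imp_subgroup[OF L]] by blast
  \<comment> \<open>The nilpotency classes may differ; at \<open>max m n\<close> both series have
    reached the top.\<close>
  obtain m n where "upper_central A m = carrier A" "upper_central B n = carrier B"
    using assms(3,6) by (auto simp: nilpotent_def)
  then have "letters \<subseteq> \<alpha> ` upper_central A (max m n) \<union> \<beta> ` upper_central B (max m n)"
    using A.upper_central_mono[of m "max m n"] B.upper_central_mono[of n "max m n"] by auto
  also have "\<dots> \<subseteq> L (max m n)"
    unfolding L_def by (rule G.normal_closure_incl)
  finally have "generate G letters \<subseteq> L (max m n)"
    by (rule G.generate_subgroup_incl) (rule normal_imp_subgroup[OF L])
  then have Ln: "L (max m n) = carrier G"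
    using generate_\<alpha>_\<beta> subgroup.subset[OF normal_imp_subgroup[OF L]] by blast
  show ?thesis
    by (rule G.poly_residually_solvable_interleave[where L = L and R = R, OF L step(1-5) L0 Ln])
qed

end
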